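(* Let $\Phi=\{\phi^t\}_{t\in\mathbb{R}}$ be a continuous flow on a compact metric space $X$. If the map $\phi^t$ is saturated for some $t>0$, then the flow $\Phi$ is saturated.
   Context: A continuous flow on a compact metric space $X$ is a continuous map $\Phi:\mathbb{R}\times X\to X$, $\phi^t(x)=\Phi(t,x)$, with $\phi^0=\mathrm{id}$ and $\phi^{s+t}=\phi^s\circ\phi^t$. For $S$ a continuous map $f:X\to X$ or a continuous flow $\Phi$, $\mathfrak{M}(S)$ is the set of $S$-invariant Borel probability measures ($\Phi$-invariant means invariant under every $\phi^t$). The metric entropy of $\Phi$ is $h_\mu(\Phi):=h_\mu(\phi^1)$ (Kolmogorov–Sinai entropy of the time-one map). Generic points: $G_\mu(f)$ is the set of $x$ with $\lim_{n\to\infty}\frac1n\sum_{j=0}^{n-1}\varphi(f^j(x))=\int\varphi\,d\mu$ for every continuous $\varphi:X\to\mathbb{R}$; $G_\mu(\Phi)$ is the set of $x$ with $\lim_{T\to\infty}\frac1T\int_0^T\varphi(\phi^t(x))\,dt=\int\varphi\,d\mu$ for every continuous $\varphi:X\to\mathbb{R}$. $S$ is saturated if $h(S,G_\mu(S))=h_\mu(S)$ for each $\mu\in\mathfrak{M}(S)$. Topological entropy $h(S,Y)$ on an arbitrary subset $Y\subseteq X$. Let $\mathcal U$ be a finite open cover of $X$. For $B\subseteq X$ write $B\prec\mathcal U$ if $B$ is contained in some element of $\mathcal U$. For the flow, let $N(B)$ be the largest nonnegative number such that $\phi^t(B)\prec\mathcal U$ for all $0\le t<N(B)$, with $N(B)=0$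 if $B\not\prec\mathcal U$ and $N(B)=\infty$ if $\phi^t(B)\prec\mathcal U$ for all $t\ge0$. Put $D(B)=e^{-N(B)}$ if $N(B)<\infty$ and $D(B)=0$ if $N(B)=\infty$. For $\alpha>0$ and a countable collection $\mathcal B=\{B_i\}_{i\ge1}$ put $S_\alpha(\mathcal B)=\sum_{i\ge1}D(B_i)^\alpha$. Put $\Gamma_\alpha(Y)=\lim_{\varepsilon\to0}\inf\{S_\alpha(\mathcal E):\mathcal E=\{E_i\}_{i\ge1}\text{ a countable cover of }Y\text{ with }D(E_i)<\varepsilon\text{ for all }i\}$, $h_{\mathcal U}(\Phi,Y)=\inf\{\alpha>0:\Gamma_\alpha(Y)=0\}$ (with $\inf\emptyset=\infty$), and $h(\Phi,Y)=\sup_{\mathcal U}h_{\mathcal U}(\Phi,Y)$ over finite open covers $\mathcal U$ of $X$. For a continuous map $f$, $h(f,Y)$ (Bowen topological entropy) is defined in the same way with $N(B)$ replaced by $n(B)$: the largest nonnegative integer such that $f^k(B)\prec\mathcal U$ for all integers $0\le k<n(B)$, with $n(B)=0$ if $B\not\prec\mathcal U$ and $n(B)=\infty$ if $f^k(B)\prec\mathcal U$ for all $k\ge0$. *)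

theory Defs
  imports "HOL-Probability.Probability"
begin

definition continuous_flow :: "(real \<Rightarrow> 'a::topological_space \<Rightarrow> 'a) \<Rightarrow> bool" where
  "continuous_flow \<Phi> \<longleftrightarrow>
     continuous_on UNIV (\<lambda>(t, x). \<Phi> t x) \<and> \<Phi> 0 = id \<and> (\<forall>s t. \<Phi> (s + t) = \<Phi> s \<circ> \<Phi> t)"

definition map_invariant_measures :: "('a::topological_space \<Rightarrow> 'a) \<Rightarrow> 'a measure set" where
  "map_invariant_measures f = {M. prob_space M \<and> sets M = sets borel \<and> distr M borel f = M}"

definition flow_invariant_measures ::
    "(real \<Rightarrow> 'a::topological_space \<Rightarrow> 'a) \<Rightarrow> 'a measure set" where
  "flow_invariant_measures \<Phi> =
     {M. prob_space M \<and> sets M = sets borel \<and> (\<forall>t. distr M borel (\<Phi> t) = M)}"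

definition finite_measurable_partition :: "'a measure \<Rightarrow> 'a set set \<Rightarrow> bool" where
  "finite_measurable_partition M P \<longleftrightarrow> finite P \<and> P \<subseteq> sets M \<and> partition_on (space M) P"

definition partition_entropy :: "'a measure \<Rightarrow> 'a set set \<Rightarrow> real" where
  "partition_entropy M P = - (\<Sum>A\<in>P. measure M A * ln (measure M A))"

definition preimage_partition :: "'a measure \<Rightarrow> ('a \<Rightarrow> 'a) \<Rightarrow> 'a set set \<Rightarrow> 'a set set" where
  "preimage_partition M g P = (\<lambda>A. g -` A \<inter> space M) ` P - {{}}"

text \<open>The join of the partitions \<open>f\<^sup>-\<^sup>i P\<close> for \<open>i < n\<close>.\<close>

definition dynamical_join :: "'a measure \<Rightarrow> ('a \<Rightarrow> 'a) \<Rightarrow> 'a set set \<Rightarrow> nat \<Rightarrow> 'a set set" where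
  "dynamical_join M f P n =
     common_refinement ((\<lambda>i. preimage_partition M (f ^^ i) P) ` {..<n})"

text \<open>The limit below exists, by subadditivity, whenever \<open>f\<close> preserves the
  probability measure \<open>M\<close>.\<close>

definition metric_entropy_partition :: "'a measure \<Rightarrow> ('a \<Rightarrow> 'a) \<Rightarrow> 'a set set \<Rightarrow> real" where
  "metric_entropy_partition M f P =
     lim (\<lambda>n. partition_entropy M (dynamical_join M f P n) / real n)"

definition metric_entropy :: "'a measure \<Rightarrow> ('a \<Rightarrow> 'a) \<Rightarrow> ereal" where
  "metric_entropy M f =
     (SUP P \<in> {P. finite_measurable_partition M P}. ereal (metric_entropy_partition M f P))"

definition flow_metric_entropy :: "'a measure \<Rightarrow> (real \<Rightarrow> 'a \<Rightarrow> 'a) \<Rightarrow> ereal" where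
  "flow_metric_entropy M \<Phi> = metric_entropy M (\<Phi> 1)"

definition map_generic_points ::
    "'a measure \<Rightarrow> ('a::topological_space \<Rightarrow> 'a) \<Rightarrow> 'a set" where
  "map_generic_points M f =
     {x. \<forall>g :: 'a \<Rightarrow> real. continuous_on UNIV g \<longrightarrow>
        (\<lambda>n. (\<Sum>j<n. g ((f ^^ j) x)) / real n) \<longlonglongrightarrow> (\<integral>y. g y \<partial>M)}"

definition flow_generic_points ::
    "'a measure \<Rightarrow> (real \<Rightarrow> 'a::topological_space \<Rightarrow> 'a) \<Rightarrow> 'a set" where
  "flow_generic_points M \<Phi> =
     {x. \<forall>g :: 'a \<Rightarrow> real. continuous_on UNIV g \<longrightarrow>
        ((\<lambda>T. integral {0..T} (\<lambda>t. g (\<Phi> t x)) / T) \<longlongrightarrow> (\<integral>y. g y \<partial>M)) at_top}"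

definition finite_open_cover :: "'a::topological_space set set \<Rightarrow> bool" where
  "finite_open_cover \<U> \<longleftrightarrow> finite \<U> \<and> (\<forall>U\<in>\<U>. open U) \<and> \<Union>\<U> = UNIV"

definition subordinate :: "'a set \<Rightarrow> 'a set set \<Rightarrow> bool" where
  "subordinate B \<U> \<longleftrightarrow> (\<exists>U\<in>\<U>. B \<subseteq> U)"

text \<open>The largest admissible \<open>T\<close> (respectively \<open>n\<close>), as a supremum in the extended
  numbers. Since \<open>0\<close> is always admissible this covers the conventions
  \<open>N(B) = 0\<close> and \<open>N(B) = \<infinity>\<close> too; the lemmas below confirm this and that a finite
  supremum is attained.\<close>

definition flow_exit_time :: "(real \<Rightarrow> 'a \<Rightarrow> 'a) \<Rightarrow> 'a set set \<Rightarrow> 'a set \<Rightarrow> ereal" where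
  "flow_exit_time \<Phi> \<U> B =
     Sup {ereal T |T. 0 \<le> T \<and> (\<forall>t. 0 \<le> t \<and> t < T \<longrightarrow> subordinate (\<Phi> t ` B) \<U>)}"

definition map_exit_time :: "('a \<Rightarrow> 'a) \<Rightarrow> 'a set set \<Rightarrow> 'a set \<Rightarrow> ereal" where
  "map_exit_time f \<U> B =
     Sup {ereal (real n) |n. \<forall>k<n. subordinate ((f ^^ k) ` B) \<U>}"

lemma flow_exit_time_ge_iff:
  assumes "0 \<le> T"
  shows "ereal T \<le> flow_exit_time \<Phi> \<U> B \<longleftrightarrow>
    (\<forall>t. 0 \<le> t \<and> t < T \<longrightarrow> subordinate (\<Phi> t ` B) \<U>)"
proof
  assume le: "ereal T \<le> flow_exit_time \<Phi> \<U> B"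
  show "\<forall>t. 0 \<le> t \<and> t < T \<longrightarrow> subordinate (\<Phi> t ` B) \<U>"
  proof (intro allI impI)
    fix t assume t: "0 \<le> t \<and> t < T"
    then have "ereal t < flow_exit_time \<Phi> \<U> B"
      by (intro less_le_trans[OF _ le]) simp
    then show "subordinate (\<Phi> t ` B) \<U>"
      using t unfolding flow_exit_time_def less_Sup_iff by auto
  qed
next
  assume "\<forall>t. 0 \<le> t \<and> t < T \<longrightarrow> subordinate (\<Phi> t ` B) \<U>"
  then show "ereal T \<le> flow_exit_time \<Phi> \<U> B"
    unfolding flow_exit_time_def using assms by (intro Sup_upper) blast
qed

lemma flow_exit_time_eq_top_iff:
  "flow_exit_time \<Phi> \<U> B = \<infinity> \<longleftrightarrow> (\<forall>t\<ge>0. subordinate (\<Phi> t ` B) \<U>)"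
proof
  assume top: "flow_exit_time \<Phi> \<U> B = \<infinity>"
  show "\<forall>t\<ge>0. subordinate (\<Phi> t ` B) \<U>"
  proof (intro allI impI)
    fix t :: real assume "0 \<le> t"
    then show "subordinate (\<Phi> t ` B) \<U>"
      using flow_exit_time_ge_iff[of "t + 1" \<Phi> \<U> B] top by auto
  qed
next
  assume *: "\<forall>t\<ge>0. subordinate (\<Phi> t ` B) \<U>"
  show "flow_exit_time \<Phi> \<U> B = \<infinity>"
  proof (rule ereal_top)
    fix T :: real
    have "ereal \<bar>T\<bar> \<le> flow_exit_time \<Phi> \<U> B"
      using * by (subst flow_exit_time_ge_iff) auto
    then show "ereal T \<le> flow_exit_time \<Phi> \<U> B"
      by (rule order_trans[rotated]) simp
  qed
qed

lemma flow_exit_time_eq_0: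
  assumes "\<not> subordinate (\<Phi> 0 ` B) \<U>"
  shows "flow_exit_time \<Phi> \<U> B = 0"
proof -
  have "T = 0" if "0 \<le> T" "\<forall>t. 0 \<le> t \<and> t < T \<longrightarrow> subordinate (\<Phi> t ` B) \<U>" for T
    using that assms by (metis order_le_less order_refl)
  then have "{ereal T |T. 0 \<le> T \<and> (\<forall>t. 0 \<le> t \<and> t < T \<longrightarrow> subordinate (\<Phi> t ` B) \<U>)} = {0}"
    by (auto simp: zero_ereal_def)
  then show ?thesis
    by (simp add: flow_exit_time_def)
qed

lemma map_exit_time_ge_iff:
  "ereal (real n) \<le> map_exit_time f \<U> B \<longleftrightarrow> (\<forall>k<n. subordinate ((f ^^ k) ` B) \<U>)"
proof
  assume le: "ereal (real n) \<le> map_exit_time f \<U> B"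
  show "\<forall>k<n. subordinate ((f ^^ k) ` B) \<U>"
  proof (intro allI impI)
    fix k assume "k < n"
    then have "ereal (real k) < map_exit_time f \<U> B"
      by (intro less_le_trans[OF _ le]) simp
    then show "subordinate ((f ^^ k) ` B) \<U>"
      unfolding map_exit_time_def less_Sup_iff by auto
  qed
next
  assume "\<forall>k<n. subordinate ((f ^^ k) ` B) \<U>"
  then show "ereal (real n) \<le> map_exit_time f \<U> B"
    unfolding map_exit_time_def by (intro Sup_upper) blast
qed

lemma map_exit_time_eq_top_iff:
  "map_exit_time f \<U> B = \<infinity> \<longleftrightarrow> (\<forall>k. subordinate ((f ^^ k) ` B) \<U>)"
proof
  assume "map_exit_time f \<U> B = \<infinity>"
  then show "\<forall>k. subordinate ((f ^^ k) ` B) \<U>"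
    using map_exit_time_ge_iff[of "Suc _" f \<U> B] by auto
next
  assume *: "\<forall>k. subordinate ((f ^^ k) ` B) \<U>"
  show "map_exit_time f \<U> B = \<infinity>"
  proof (rule ereal_top)
    fix T :: real
    obtain n :: nat where "T \<le> real n"
      using real_arch_simple by blast
    then show "ereal T \<le> map_exit_time f \<U> B"
      using * map_exit_time_ge_iff[of n f \<U> B] by (meson ereal_less_eq(3) order_trans)
  qed
qed

text \<open>The remaining construction depends on the dynamics only through the function
  \<open>N\<close> assigning to a cover \<open>\<U>\<close> and a set \<open>B\<close> the exit time of \<open>B\<close>.\<close>

definition exit_weight :: "('a set \<Rightarrow> ereal) \<Rightarrow> 'a set \<Rightarrow> real" where
  "exit_weight N B = (if N B = \<infinity> then 0 else exp (- real_of_ereal (N B)))"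

text \<open>Countable covers are sequences of sets; finite ones are padded with \<open>{}\<close>, which
  has weight \<open>0\<close> since its exit time is infinite. Note that \<open>0 powr \<alpha> = 0\<close>.\<close>

definition cover_sum :: "('a set \<Rightarrow> ereal) \<Rightarrow> real \<Rightarrow> (nat \<Rightarrow> 'a set) \<Rightarrow> ennreal" where
  "cover_sum N \<alpha> E = (\<Sum>i. ennreal (exit_weight N (E i) powr \<alpha>))"

definition fine_cover_inf :: "('a set \<Rightarrow> ereal) \<Rightarrow> 'a set \<Rightarrow> real \<Rightarrow> real \<Rightarrow> ennreal" where
  "fine_cover_inf N Y \<alpha> \<epsilon> =
     (INF E \<in> {E. Y \<subseteq> (\<Union>i. E i) \<and> (\<forall>i. exit_weight N (E i) < \<epsilon>)}. cover_sum N \<alpha> E)"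

definition entropy_outer_measure :: "('a set \<Rightarrow> ereal) \<Rightarrow> 'a set \<Rightarrow> real \<Rightarrow> ennreal" where
  "entropy_outer_measure N Y \<alpha> = Lim (at_right 0) (fine_cover_inf N Y \<alpha>)"

lemma fine_cover_inf_antimono:
  "\<epsilon> \<le> \<delta> \<Longrightarrow> fine_cover_inf N Y \<alpha> \<delta> \<le> fine_cover_inf N Y \<alpha> \<epsilon>"
  unfolding fine_cover_inf_def by (rule INF_superset_mono) (force intro: less_le_trans)+

lemma fine_cover_inf_tendsto:
  "(fine_cover_inf N Y \<alpha> \<longlongrightarrow> (SUP \<epsilon>\<in>{0<..}. fine_cover_inf N Y \<alpha> \<epsilon>)) (at_right 0)"
proof (rule order_tendstoI)
  fix a assume "a < (SUP \<epsilon>\<in>{0<..}. fine_cover_inf N Y \<alpha> \<epsilon>)"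
  then obtain \<delta> :: real where \<delta>: "\<delta> > 0" "a < fine_cover_inf N Y \<alpha> \<delta>"
    by (auto simp: less_SUP_iff)
  show "\<forall>\<^sub>F \<epsilon> in at_right 0. a < fine_cover_inf N Y \<alpha> \<epsilon>"
    unfolding eventually_at_right_field
    using \<delta> fine_cover_inf_antimono[of _ \<delta> N Y \<alpha>] by (meson less_imp_le less_le_trans)
next
  fix a assume a: "(SUP \<epsilon>\<in>{0<..}. fine_cover_inf N Y \<alpha> \<epsilon>) < a"
  have "fine_cover_inf N Y \<alpha> \<epsilon> < a" if "\<epsilon> > 0" for \<epsilon> :: real
    using that by (intro le_less_trans[OF _ a] SUP_upper) simp
  then show "\<forall>\<^sub>F \<epsilon> in at_right 0. fine_cover_inf N Y \<alpha> \<epsilon> < a"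
    unfolding eventually_at_right_field by (intro exI[of _ 1]) auto
qed

lemma entropy_outer_measure_eq_SUP:
  "entropy_outer_measure N Y \<alpha> = (SUP \<epsilon>\<in>{0<..}. fine_cover_inf N Y \<alpha> \<epsilon>)"
  unfolding entropy_outer_measure_def
  by (rule tendsto_Lim[OF _ fine_cover_inf_tendsto]) simp

definition cover_entropy :: "('a set \<Rightarrow> ereal) \<Rightarrow> 'a set \<Rightarrow> ereal" where
  "cover_entropy N Y = Inf {ereal \<alpha> |\<alpha>. 0 < \<alpha> \<and> entropy_outer_measure N Y \<alpha> = 0}"

definition flow_topological_entropy ::
    "(real \<Rightarrow> 'a::topological_space \<Rightarrow> 'a) \<Rightarrow> 'a set \<Rightarrow> ereal" where
  "flow_topological_entropy \<Phi> Y =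
     (SUP \<U> \<in> {\<U>. finite_open_cover \<U>}. cover_entropy (flow_exit_time \<Phi> \<U>) Y)"

definition map_topological_entropy ::
    "('a::topological_space \<Rightarrow> 'a) \<Rightarrow> 'a set \<Rightarrow> ereal" where
  "map_topological_entropy f Y =
     (SUP \<U> \<in> {\<U>. finite_open_cover \<U>}. cover_entropy (map_exit_time f \<U>) Y)"

definition map_saturated :: "('a::topological_space \<Rightarrow> 'a) \<Rightarrow> bool" where
  "map_saturated f \<longleftrightarrow> (\<forall>M \<in> map_invariant_measures f.
     map_topological_entropy f (map_generic_points M f) = metric_entropy M f)"

definition flow_saturated :: "(real \<Rightarrow> 'a::topological_space \<Rightarrow> 'a) \<Rightarrow> bool" where
  "flow_saturated \<Phi> \<longleftrightarrow> (\<forall>M \<in> flow_invariant_measures \<Phi>.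
     flow_topological_entropy \<Phi> (flow_generic_points M \<Phi>) = flow_metric_entropy M \<Phi>)"

end

theory Submission
  imports Defs "HOL-Real_Asymp.Real_Asymp"
begin

text \<open>
  Fix an invariant measure \<open>M\<close> of the flow and write \<open>G\<close> for its generic points under the flow.
  The entropy \<open>h(\<Phi>, G)\<close> is squeezed between two bounds.

  Lower bound. Suppose \<open>\<phi>\<^sup>\<tau>\<close> is saturated. Points generic under \<open>\<phi>\<^sup>\<tau>\<close> are generic under the flow,
  since the average over \<open>[0, n\<tau>]\<close> is the average over offsets \<open>s \<in> [0, \<tau>]\<close> of Birkhoff averages of the
  observables \<open>g \<circ> \<phi>\<^sup>s\<close>, all with the same integral. A set that stays subordinate to a cover
  for flow time \<open>T\<close> does so for about \<open>T / \<tau>\<close> iterates, so \<open>h(\<phi>\<^sup>\<tau>, Y) \<le> \<tau> h(\<Phi>, Y)\<close>. Together with saturation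
  this gives \<open>h\<^sub>M(\<phi>\<^sup>\<tau>) / \<tau> \<le> h(\<Phi>, G)\<close>. It remains to compare \<open>h\<^sub>M(\<phi>\<^sup>\<tau>)\<close> with \<open>h\<^sub>M(\<phi>\<^sup>1)\<close>, which is the half
  \<open>h\<^sub>M(\<phi>\<^sup>1) \<le> h\<^sub>M(\<phi>\<^sup>\<tau>) / \<tau>\<close> of Abramov's formula (\<open>time_scaled_metric_entropy_le\<close>): when \<open>\<sigma> = \<tau> / m\<close> is small,
  a finite partition \<open>P\<close> is nearly invariant under \<open>\<phi>\<^sup>s\<close> for \<open>\<bar>s\<bar> < \<sigma>\<close>, so the \<open>P\<close>-name of a point sampled
  at integer times is determined, up to a small entropy per step, by its name sampled at multiples of \<open>\<sigma>\<close>,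
  and for these times \<open>h(\<phi>\<^sup>\<sigma>, P) = h(\<phi>\<^sup>\<tau>, Q) / m\<close> for a suitable join \<open>Q\<close>.

  Upper bound. The inequality \<open>h(\<Phi>, G) \<le> h\<^sub>M(\<phi>\<^sup>1)\<close> is Bowen's bound, proved here directly for the flow
  (\<open>cover_entropy_generic_points_le\<close>). Given a cover, take a partition into small pieces whose boundaries are
  null and a number \<open>m\<close> of steps such that the \<open>m\<close>-step itinerary \<open>q\<close> has entropy below \<open>\<alpha>m\<close>,
  where \<open>\<alpha> > h\<^sub>M(\<phi>\<^sup>1)\<close>. Give a value \<open>u\<close> of \<open>q\<close> the cost \<open>- ln w(u)\<close>, where \<open>w(u)\<close> is slightly
  larger than the probability of \<open>u\<close>. The mean cost is at most the entropy of \<open>q\<close>. By genericity,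
  the cost averaged along the orbit of a point of \<open>G\<close> is about the mean cost. Splitting the orbit
  according to the offset \<open>s \<in> [-m, 0]\<close>, at least one of the words \<open>(q(\<phi>\<^sup>s\<^sup>+\<^sup>j\<^sup>m x))\<close>, \<open>j < n\<close>, costs no
  more than the average. Cheap words are few: the
  products of the weights of all words of length \<open>n\<close> sum to \<open>(\<Sum>u. w u)\<^sup>n\<close>, a number close to \<open>1\<close> on the
  exponential scale, while a word of cost at most \<open>nc\<close> contributes at least \<open>exp (-nc)\<close>. Two points with the
  same word and almost the same offset stay close for time \<open>(n - 1)m\<close>. So each point of \<open>G\<close> lies, for all
  large \<open>n\<close>, in one of exponentially fewer than \<open>exp (\<alpha>nm)\<close> sets with exit time at least \<open>(n - 1)m\<close>.
\<close>

section \<open>Subadditive sequences\<close>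

text \<open>
  Fekete's lemma; the limit is the infimum of the quotients, because dividing \<open>n\<close> by a fixed \<open>m\<close> with
  remainder bounds \<open>a n\<close> by a multiple of \<open>a m\<close> and a constant.
\<close>

lemma subadditive_imp_convergent:
  fixes a :: "nat \<Rightarrow> real"
  assumes nonneg: "\<And>n. 0 \<le> a n" and sub: "\<And>m n. a (m + n) \<le> a m + a n"
  shows "convergent (\<lambda>n. a n / real n)"
proof -
  define L where "L = (INF n\<in>{1..}. a n / real n)"
  have bdd: "bdd_below ((\<lambda>n. a n / real n) ` {1..})"
    by (rule bdd_belowI[of _ 0]) (use nonneg in auto)
  have mult: "a (q * m + r) \<le> real q * a m + a r" for q m r
  proof (induction q)
    case (Suc q)
    then show ?case
      using sub[of m "q * m + r"] by (simp add: algebra_simps)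
  qed simp
  have "(\<lambda>n. a n / real n) \<longlonglongrightarrow> L"
  proof (rule order_tendstoI)
    fix l assume "l < L"
    have "l < a n / real n" if "n \<ge> 1" for n
      using cINF_lower[OF bdd, of n] that \<open>l < L\<close> unfolding L_def by simp
    then show "\<forall>\<^sub>F n in sequentially. l < a n / real n"
      using eventually_sequentially by blast
  next
    fix u assume "L < u"
    then obtain m :: nat where m: "m \<ge> 1" "a m / real m < u"
      unfolding L_def by (subst (asm) cINF_less_iff) (use bdd in auto)
    \<comment> \<open>Any common bound of the finitely many values at possible remainders will do.\<close>
    define C where "C = (\<Sum>r<m. a r)"
    have C: "a r \<le> C" if "r < m" for r
      unfolding C_def by (rule member_le_sum) (use that nonneg in auto)
    have bound: "a n / real n \<le> a m / real m + C / real n" if n: "n \<ge> 1" for n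
    proof -
      have "a n = a (n div m * m + n mod m)" by simp
      also have "\<dots> \<le> real (n div m) * a m + a (n mod m)" by (rule mult)
      also have "\<dots> \<le> real (n div m) * a m + C" using C[of "n mod m"] m by simp
      also have "real (n div m) \<le> real n / real m" by (rule of_nat_div_le_of_nat)
      finally have "a n \<le> real n / real m * a m + C"
        using nonneg[of m] by (simp add: mult_right_mono)
      then show ?thesis using n m by (simp add: field_simps)
    qed
    have "(\<lambda>n. a m / real m + C / real n) \<longlonglongrightarrow> a m / real m + 0"
      by (intro tendsto_intros lim_const_over_n)
    then have "\<forall>\<^sub>F n in sequentially. a m / real m + C / real n < u"
      using m by (intro order_tendstoD) auto
    then show "\<forall>\<^sub>F n in sequentially. a n / real n < u"
      using eventually_ge_at_top[of 1]
      by eventually_elim (use bound in \<open>auto intro: le_less_trans\<close>)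
  qed
  then show ?thesis by (auto simp: convergent_def)
qed

section \<open>Entropy of functions with finitely many values\<close>

text \<open>
  Strong subadditivity of the entropy of a finite distribution, in the form that conditioning on \<open>b\<close> in
  addition to \<open>c\<close> does not increase the entropy of \<open>a\<close>. The difference of the two sides is a mean of
  \<open>ln\<close> of the density ratio between the law that makes \<open>a\<close> and \<open>b\<close> independent given \<open>c\<close> and the
  law \<open>p\<close>; it is estimated by \<open>ln x \<le> x - 1\<close>, and both laws have the same total mass.
\<close>

lemma sum_entropy_submodular:
  fixes p :: "'a \<Rightarrow> 'b \<Rightarrow> 'c \<Rightarrow> real"
  assumes "finite A" "finite B" "finite C" and nonneg: "\<And>a b c. 0 \<le> p a b c"
  defines "pac \<equiv> \<lambda>a c. \<Sum>b\<in>B. p a b c" and "pbc \<equiv> \<lambda>b c. \<Sum>a\<in>A. p a b c"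
    and "pc \<equiv> \<lambda>c. \<Sum>a\<in>A. \<Sum>b\<in>B. p a b c"
  shows "(\<Sum>a\<in>A. \<Sum>c\<in>C. pac a c * ln (pac a c)) + (\<Sum>b\<in>B. \<Sum>c\<in>C. pbc b c * ln (pbc b c))
    \<le> (\<Sum>a\<in>A. \<Sum>b\<in>B. \<Sum>c\<in>C. p a b c * ln (p a b c)) + (\<Sum>c\<in>C. pc c * ln (pc c))"
proof -
  have ge_ac: "p a b c \<le> pac a c" if "b \<in> B" for a b c
    unfolding pac_def by (rule member_le_sum[OF that]) (use assms in auto)
  have ge_bc: "p a b c \<le> pbc b c" if "a \<in> A" for a b c
    unfolding pbc_def by (rule member_le_sum[OF that]) (use assms in auto)
  have pc_ac: "pc c = (\<Sum>a\<in>A. pac a c)" for c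
    by (simp add: pc_def pac_def)
  have pc_bc: "pc c = (\<Sum>b\<in>B. pbc b c)" for c
    unfolding pc_def pbc_def by (rule sum.swap)
  have pos_c: "pac a c \<le> pc c" if "a \<in> A" for a c
    unfolding pc_ac by (rule member_le_sum[OF that]) (use assms in \<open>auto intro: sum_nonneg\<close>)
  have nn: "0 \<le> pac a c" "0 \<le> pbc b c" "0 \<le> pc c" for a b c
    by (auto simp: pac_def pbc_def pc_def nonneg intro!: sum_nonneg)
  have pw: "p a b c * (ln (pac a c) + ln (pbc b c) - ln (p a b c) - ln (pc c))
      \<le> pac a c * pbc b c / pc c - p a b c" if ab: "a \<in> A" "b \<in> B" for a b c
  proof (cases "p a b c = 0")
    case True
    then show ?thesis using nn by simp
  next
    case False
    then have pos: "0 < p a b c" using nonneg[of a b c] by simp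
    with ge_ac[of b a c] ge_bc[of a b c] pos_c[of a c] ab
    have pos': "0 < pac a c" "0 < pbc b c" "0 < pc c" by auto
    have "ln (pac a c) + ln (pbc b c) - ln (p a b c) - ln (pc c)
        = ln (pac a c * pbc b c / (p a b c * pc c))"
      using pos pos' by (simp add: ln_div ln_mult)
    also have "\<dots> \<le> pac a c * pbc b c / (p a b c * pc c) - 1"
      using pos pos' by (intro ln_le_minus_one) simp
    finally have "p a b c * (ln (pac a c) + ln (pbc b c) - ln (p a b c) - ln (pc c))
        \<le> p a b c * (pac a c * pbc b c / (p a b c * pc c) - 1)"
      using pos by (intro mult_left_mono) auto
    also have "\<dots> = pac a c * pbc b c / pc c - p a b c"
      using pos pos' by (simp add: field_simps)
    finally show ?thesis .
  qed
  have "(\<Sum>a\<in>A. \<Sum>c\<in>C. pac a c * ln (pac a c)) = (\<Sum>a\<in>A. \<Sum>b\<in>B. \<Sum>c\<in>C. p a b c * ln (pac a c))"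
    by (subst sum.swap[of _ C B]) (simp add: pac_def sum_distrib_right)
  moreover have "(\<Sum>b\<in>B. \<Sum>c\<in>C. pbc b c * ln (pbc b c))
      = (\<Sum>a\<in>A. \<Sum>b\<in>B. \<Sum>c\<in>C. p a b c * ln (pbc b c))"
    by (subst sum.swap[of _ B A], subst sum.swap[of _ C A]) (simp add: pbc_def sum_distrib_right)
  moreover have "(\<Sum>c\<in>C. pc c * ln (pc c)) = (\<Sum>a\<in>A. \<Sum>b\<in>B. \<Sum>c\<in>C. p a b c * ln (pc c))"
    by (subst sum.swap[of _ C B], subst sum.swap[of _ C A]) (simp add: pc_def sum_distrib_right)
  ultimately have "(\<Sum>a\<in>A. \<Sum>c\<in>C. pac a c * ln (pac a c)) + (\<Sum>b\<in>B. \<Sum>c\<in>C. pbc b c * ln (pbc b c))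
      - (\<Sum>a\<in>A. \<Sum>b\<in>B. \<Sum>c\<in>C. p a b c * ln (p a b c)) - (\<Sum>c\<in>C. pc c * ln (pc c))
    = (\<Sum>a\<in>A. \<Sum>b\<in>B. \<Sum>c\<in>C. p a b c * (ln (pac a c) + ln (pbc b c) - ln (p a b c) - ln (pc c)))"
    by (simp add: algebra_simps sum.distrib sum_subtractf)
  also have "\<dots> \<le> (\<Sum>a\<in>A. \<Sum>b\<in>B. \<Sum>c\<in>C. pac a c * pbc b c / pc c - p a b c)"
    by (intro sum_mono pw)
  also have "\<dots> = (\<Sum>c\<in>C. \<Sum>a\<in>A. \<Sum>b\<in>B. pac a c * pbc b c / pc c - p a b c)"
    by (subst sum.swap[of _ C B], subst sum.swap[of _ C A]) simp
  also have "\<dots> = (\<Sum>c\<in>C. (\<Sum>a\<in>A. pac a c) * (\<Sum>b\<in>B. pbc b c) / pc c - pc c)"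
    by (simp add: sum_subtractf pc_def sum_product sum_divide_distrib)
  also have "\<dots> = (\<Sum>c\<in>C. 0)"
    by (intro sum.cong refl) (simp flip: pc_ac pc_bc)
  finally show ?thesis by simp
qed

text \<open>
  Partitions are handled as level sets of functions: a join becomes a tuple of functions, a preimage becomes
  a composition, and the dynamical join becomes the itinerary.
\<close>

definition level_sets :: "('a \<Rightarrow> 'b) \<Rightarrow> 'a set set" where
  "level_sets X = range (\<lambda>x. X -` {X x})"

text \<open>
  The entropy of a function depends only on which pairs of points it separates; this is how tuples are
  rearranged and redundant components dropped.
\<close>

lemma level_sets_cong:
  assumes "\<And>x y. X x = X y \<longleftrightarrow> Y x = Y y"
  shows "level_sets X = level_sets Y"
proof -
  have "X -` {X x} = Y -` {Y x}" for x
    using assms by auto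
  then show ?thesis by (simp add: level_sets_def)
qed

lemma level_sets_eq_image: "level_sets X = (\<lambda>v. X -` {v}) ` range X"
  by (auto simp: level_sets_def)

definition itinerary :: "('a \<Rightarrow> 'a) \<Rightarrow> ('a \<Rightarrow> 'b) \<Rightarrow> nat \<Rightarrow> 'a \<Rightarrow> 'b list" where
  "itinerary f X n x = map (\<lambda>i. X ((f ^^ i) x)) [0..<n]"

lemma itinerary_eq_iff:
  "itinerary f X n x = itinerary f X n y \<longleftrightarrow> (\<forall>i<n. X ((f ^^ i) x) = X ((f ^^ i) y))"
  by (auto simp: itinerary_def)

text \<open>
  A block of the common refinement is determined by any of its points \<open>x\<close>: for each \<open>i\<close> the chosen set
  must be the one that contains \<open>x\<close>.
\<close>

lemma dynamical_join_level_sets: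
  assumes "space M = UNIV"
  shows "dynamical_join M f (level_sets X) n = level_sets (itinerary f X n)"
proof -
  define Q where "Q i = preimage_partition M (f ^^ i) (level_sets X)" for i
  have Q: "Q i = (\<lambda>v. {y. X ((f ^^ i) y) = v}) ` range X - {{}}" for i
    by (auto simp: Q_def preimage_partition_def level_sets_eq_image assms image_image vimage_def)
  have block: "B = {y. X ((f ^^ i) y) = X ((f ^^ i) x)}" if "B \<in> Q i" "x \<in> B" for B i x
    using that by (auto simp: Q)
  have mem: "{y. X ((f ^^ i) y) = X ((f ^^ i) x)} \<in> Q i" for i x
    by (auto simp: Q)
  have lev: "level_sets (itinerary f X n)
      = range (\<lambda>x. {y. \<forall>i<n. X ((f ^^ i) y) = X ((f ^^ i) x)})"
    unfolding level_sets_def by (simp add: vimage_def itinerary_eq_iff)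
  have "common_refinement (Q ` {..<n}) = range (\<lambda>x. {y. \<forall>i<n. X ((f ^^ i) y) = X ((f ^^ i) x)})"
  proof (intro equalityI subsetI)
    fix D assume "D \<in> common_refinement (Q ` {..<n})"
    then obtain g where g: "g \<in> (\<Pi>\<^sub>E P\<in>Q ` {..<n}. P)" "D = \<Inter>(g ` Q ` {..<n})" "D \<noteq> {}"
      unfolding common_refinement_def by auto
    then obtain x where x: "x \<in> D" by auto
    have "g (Q i) = {y. X ((f ^^ i) y) = X ((f ^^ i) x)}" if "i < n" for i
      using g x that by (intro block) (auto simp: PiE_iff)
    then have "D = {y. \<forall>i<n. X ((f ^^ i) y) = X ((f ^^ i) x)}"
      unfolding g(2) by auto
    then show "D \<in> range (\<lambda>x. {y. \<forall>i<n. X ((f ^^ i) y) = X ((f ^^ i) x)})"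
      by auto
  next
    fix D assume "D \<in> range (\<lambda>x. {y. \<forall>i<n. X ((f ^^ i) y) = X ((f ^^ i) x)})"
    then obtain x where D: "D = {y. \<forall>i<n. X ((f ^^ i) y) = X ((f ^^ i) x)}" by auto
    define g where "g = restrict (\<lambda>P. SOME B. B \<in> P \<and> x \<in> B) (Q ` {..<n})"
    have g: "g (Q i) \<in> Q i \<and> x \<in> g (Q i)" if "i < n" for i
    proof -
      have "\<exists>B. B \<in> Q i \<and> x \<in> B" using mem[of i x] by auto
      from someI_ex[OF this] that show ?thesis by (auto simp: g_def)
    qed
    then have gi: "g (Q i) = {y. X ((f ^^ i) y) = X ((f ^^ i) x)}" if "i < n" for i
      using that block by blast
    have "g \<in> (\<Pi>\<^sub>E P\<in>Q ` {..<n}. P)"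
      using g by (auto simp: PiE_iff g_def extensional_def)
    moreover have "D = \<Inter>(g ` Q ` {..<n})"
      unfolding D using gi by auto
    moreover have "D \<noteq> {}" unfolding D by auto
    ultimately show "D \<in> common_refinement (Q ` {..<n})"
      unfolding common_refinement_def by blast
  qed
  then show ?thesis
    by (simp add: dynamical_join_def lev flip: Q_def)
qed

text \<open>
  The space is the whole type, so that preimages are sets of the space without further intersection. The
  entropy \<open>H X\<close> below is that of the partition into level sets of \<open>X\<close>.
\<close>

locale full_prob_space = prob_space M for M :: "'a measure" +
  assumes space_eq_UNIV: "space M = UNIV"
begin

definition label :: "('a \<Rightarrow> 'b) \<Rightarrow> bool" where
  "label X \<longleftrightarrow> finite (range X) \<and> (\<forall>v. X -` {v} \<in> sets M)"

definition preserves :: "('a \<Rightarrow> 'a) \<Rightarrow> bool" where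
  "preserves f \<longleftrightarrow> (\<forall>A\<in>sets M. f -` A \<in> sets M \<and> prob (f -` A) = prob A)"

abbreviation H :: "('a \<Rightarrow> 'b) \<Rightarrow> real" where
  "H X \<equiv> partition_entropy M (level_sets X)"

lemma label_finite: "label X \<Longrightarrow> finite (range X)"
  and label_sets: "label X \<Longrightarrow> X -` {v} \<in> sets M"
  by (auto simp: label_def)

lemma label_sets_Collect: "label X \<Longrightarrow> {x. X x = v} \<in> sets M"
  using label_sets[of X v] by (simp add: vimage_def)

lemma sets_Collect_conj_UNIV:
  "{x. P x} \<in> sets M \<Longrightarrow> {x. Q x} \<in> sets M \<Longrightarrow> {x. P x \<and> Q x} \<in> sets M"
  by (auto simp: Collect_conj_eq)

lemma label_Pair:
  assumes "label X" "label Y"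
  shows "label (\<lambda>x. (X x, Y x))"
proof -
  have "range (\<lambda>x. (X x, Y x)) \<subseteq> range X \<times> range Y" by auto
  then have "finite (range (\<lambda>x. (X x, Y x)))"
    using assms by (meson finite_SigmaI finite_subset label_finite)
  moreover have "(\<lambda>x. (X x, Y x)) -` {v} = X -` {fst v} \<inter> Y -` {snd v}" for v
    by (cases v) auto
  ultimately show ?thesis
    using assms by (auto simp: label_def)
qed

lemma label_comp:
  assumes "label X"
  shows "label (\<lambda>x. g (X x))"
proof -
  have "range (\<lambda>x. g (X x)) = g ` range X" by auto
  moreover have "(\<lambda>x. g (X x)) -` {v} = (\<Union>u\<in>{u\<in>range X. g u = v}. X -` {u})" for v
    by auto
  moreover have "(\<Union>u\<in>{u\<in>range X. g u = v}. X -` {u}) \<in> sets M" for v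
    using assms by (intro sets.finite_UN) (auto simp: label_def)
  ultimately show ?thesis
    using assms by (simp add: label_def)
qed

lemma label_preserves:
  assumes "label X" "preserves f"
  shows "label (\<lambda>x. X (f x))"
proof -
  have "finite (range (\<lambda>x. X (f x)))"
    by (rule finite_subset[OF _ label_finite[OF assms(1)]]) auto
  moreover have "(\<lambda>x. X (f x)) -` {v} = f -` (X -` {v})" for v by auto
  ultimately show ?thesis
    using assms by (simp add: label_def preserves_def)
qed

lemma label_const: "label (\<lambda>_. c)"
  using sets.top[of M] by (auto simp: label_def vimage_def space_eq_UNIV)

lemma preserves_funpow:
  assumes "preserves f"
  shows "preserves (f ^^ n)"
proof (induction n)
  case 0
  show ?case by (simp add: preserves_def)
next
  case (Suc n)
  have "(f ^^ Suc n) -` A = (f ^^ n) -` (f -` A)" for A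
    by auto
  then show ?case using Suc assms unfolding preserves_def by metis
qed

lemma label_map_upt:
  assumes "\<And>i. i < n \<Longrightarrow> label (W i)"
  shows "label (\<lambda>x. map (\<lambda>i. W i x) [0..<n])"
  using assms
proof (induction n)
  case 0
  show ?case by (simp add: label_const)
next
  case (Suc n)
  then have "label (\<lambda>x. (map (\<lambda>i. W i x) [0..<n], W n x))"
    by (intro label_Pair) auto
  from label_comp[OF this, of "\<lambda>(u, v). u @ [v]"] show ?case by simp
qed

lemma label_itinerary:
  assumes "label X" "preserves f"
  shows "label (itinerary f X n)"
proof -
  have "itinerary f X n = (\<lambda>x. map (\<lambda>i. X ((f ^^ i) x)) [0..<n])"
    by (simp add: fun_eq_iff itinerary_def)
  then show ?thesis
    by (simp add: label_map_upt label_preserves preserves_funpow assms)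
qed

lemma H_eq_sum:
  assumes "finite S" "range X \<subseteq> S"
  shows "H X = - (\<Sum>v\<in>S. prob (X -` {v}) * ln (prob (X -` {v})))"
proof -
  have "inj_on (\<lambda>v. X -` {v}) (range X)"
    by (rule inj_onI) blast
  then have "H X = - (\<Sum>v\<in>range X. prob (X -` {v}) * ln (prob (X -` {v})))"
    by (simp add: partition_entropy_def level_sets_eq_image sum.reindex)
  also have "(\<Sum>v\<in>range X. prob (X -` {v}) * ln (prob (X -` {v})))
      = (\<Sum>v\<in>S. prob (X -` {v}) * ln (prob (X -` {v})))"
  proof (rule sum.mono_neutral_left[OF assms])
    show "\<forall>v\<in>S - range X. prob (X -` {v}) * ln (prob (X -` {v})) = 0"
    proof
      fix v assume "v \<in> S - range X"
      then have "X -` {v} = {}" by auto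
      then show "prob (X -` {v}) * ln (prob (X -` {v})) = 0" by simp
    qed
  qed
  finally show ?thesis .
qed

lemma H_nonneg: "0 \<le> H X"
proof -
  have "prob A * ln (prob A) \<le> 0" for A
    by (cases "prob A = 0") (auto intro!: mult_nonneg_nonpos simp: zero_less_measure_iff)
  then show ?thesis
    unfolding partition_entropy_def by (simp add: sum_nonpos)
qed

lemma H_const: "H (\<lambda>_. c) = 0"
  using prob_space by (simp add: partition_entropy_def level_sets_def vimage_def space_eq_UNIV)

lemma H_cong: "(\<And>x y. X x = X y \<longleftrightarrow> Y x = Y y) \<Longrightarrow> H X = H Y"
  using level_sets_cong[of X Y] by simp

lemma H_preserves:
  assumes "label X" "preserves f"
  shows "H (\<lambda>x. X (f x)) = H X"
proof -
  have "prob ((\<lambda>x. X (f x)) -` {v}) = prob (X -` {v})" for v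
  proof -
    have "(\<lambda>x. X (f x)) -` {v} = f -` (X -` {v})" by auto
    then show ?thesis using assms by (simp add: preserves_def label_def)
  qed
  moreover have "range (\<lambda>x. X (f x)) \<subseteq> range X" by auto
  ultimately show ?thesis
    using label_finite[OF assms(1)] by (simp add: H_eq_sum[of "range X"])
qed

lemma prob_sum_label:
  assumes "label Y" "{x. P x} \<in> sets M"
  shows "prob {x. P x} = (\<Sum>v\<in>range Y. prob {x. P x \<and> Y x = v})"
proof -
  have "{x. P x} = (\<Union>v\<in>range Y. {x. P x \<and> Y x = v})" by auto
  also have "prob \<dots> = (\<Sum>v\<in>range Y. prob {x. P x \<and> Y x = v})"
    using assms
    by (intro finite_measure_finite_Union)
       (auto simp: disjoint_family_on_def label_finite intro!: sets_Collect_conj_UNIV label_sets_Collect)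
  finally show ?thesis .
qed

lemma H_Pair_eq_sum:
  assumes "label X" "label Y"
  shows "H (\<lambda>x. (X x, Y x)) = - (\<Sum>u\<in>range X. \<Sum>v\<in>range Y.
    prob {x. X x = u \<and> Y x = v} * ln (prob {x. X x = u \<and> Y x = v}))"
proof -
  have "range (\<lambda>x. (X x, Y x)) \<subseteq> range X \<times> range Y" by auto
  moreover have "(\<lambda>x. (X x, Y x)) -` {(u, v)} = {x. X x = u \<and> Y x = v}" for u v by auto
  ultimately show ?thesis
    using assms by (subst H_eq_sum[of "range X \<times> range Y"])
      (auto simp: label_finite sum.cartesian_product intro!: sum.cong)
qed

lemma H_le_Pair:
  assumes "label X" "label Y"
  shows "H X \<le> H (\<lambda>x. (X x, Y x))"
proof -
  have "prob {x. X x = u \<and> Y x = v} * ln (prob {x. X x = u \<and> Y x = v})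
      \<le> prob {x. X x = u \<and> Y x = v} * ln (prob (X -` {u}))" for u v
  proof (cases "prob {x. X x = u \<and> Y x = v} = 0")
    case False
    then have "0 < prob {x. X x = u \<and> Y x = v}"
      by (simp add: zero_less_measure_iff)
    moreover have "prob {x. X x = u \<and> Y x = v} \<le> prob (X -` {u})"
      using assms by (intro finite_measure_mono) (auto simp: label_sets)
    ultimately show ?thesis by (intro mult_left_mono) auto
  qed simp
  then have "(\<Sum>u\<in>range X. \<Sum>v\<in>range Y.
      prob {x. X x = u \<and> Y x = v} * ln (prob {x. X x = u \<and> Y x = v}))
    \<le> (\<Sum>u\<in>range X. \<Sum>v\<in>range Y. prob {x. X x = u \<and> Y x = v} * ln (prob (X -` {u})))"
    by (intro sum_mono)
  also have "\<dots> = (\<Sum>u\<in>range X. prob (X -` {u}) * ln (prob (X -` {u})))"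
  proof (rule sum.cong[OF refl])
    fix u
    have "prob (X -` {u}) = (\<Sum>v\<in>range Y. prob {x. X x = u \<and> Y x = v})"
      using prob_sum_label[OF assms(2) label_sets_Collect[OF assms(1)]] by (simp add: vimage_def)
    then show "(\<Sum>v\<in>range Y. prob {x. X x = u \<and> Y x = v} * ln (prob (X -` {u})))
        = prob (X -` {u}) * ln (prob (X -` {u}))"
      by (simp add: sum_distrib_right)
  qed
  finally show ?thesis
    using assms by (simp add: H_Pair_eq_sum H_eq_sum[of "range X" X] label_finite)
qed

lemma H_submodular:
  assumes A: "label A" and B: "label B" and C: "label C"
  shows "H (\<lambda>x. (A x, B x, C x)) + H C \<le> H (\<lambda>x. (A x, C x)) + H (\<lambda>x. (B x, C x))"
proof -
  define p where "p a b c = prob {x. A x = a \<and> B x = b \<and> C x = c}" for a b c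
  note ss = sets_Collect_conj_UNIV label_sets_Collect A B C
  have pac: "prob {x. A x = a \<and> C x = c} = (\<Sum>b\<in>range B. p a b c)" for a c
    unfolding p_def using prob_sum_label[OF B, of "\<lambda>x. A x = a \<and> C x = c"]
    by (simp add: ss conj_ac)
  have pbc: "prob {x. B x = b \<and> C x = c} = (\<Sum>a\<in>range A. p a b c)" for b c
    unfolding p_def using prob_sum_label[OF A, of "\<lambda>x. B x = b \<and> C x = c"]
    by (simp add: ss conj_ac)
  have pc: "prob (C -` {c}) = (\<Sum>a\<in>range A. \<Sum>b\<in>range B. p a b c)" for c
  proof -
    have "prob (C -` {c}) = (\<Sum>a\<in>range A. prob {x. C x = c \<and> A x = a})"
      using prob_sum_label[OF A, of "\<lambda>x. C x = c"] by (simp add: ss vimage_def)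
    then show ?thesis by (simp add: pac conj_commute)
  qed
  have "H (\<lambda>x. (A x, B x, C x))
      = - (\<Sum>a\<in>range A. \<Sum>b\<in>range B. \<Sum>c\<in>range C. p a b c * ln (p a b c))"
  proof -
    have "range (\<lambda>x. (A x, B x, C x)) \<subseteq> range A \<times> range B \<times> range C" by auto
    moreover have "(\<lambda>x. (A x, B x, C x)) -` {(a, b, c)} = {x. A x = a \<and> B x = b \<and> C x = c}"
      for a b c by auto
    ultimately show ?thesis
      using A B C by (subst H_eq_sum[of "range A \<times> range B \<times> range C"])
        (auto simp: label_finite sum.cartesian_product p_def intro!: sum.cong)
  qed
  moreover have "H C = - (\<Sum>c\<in>range C. prob (C -` {c}) * ln (prob (C -` {c})))"
    using C by (intro H_eq_sum) (auto simp: label_finite)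
  ultimately show ?thesis
    using sum_entropy_submodular[of "range A" "range B" "range C" p] A B C
    by (simp add: H_Pair_eq_sum label_finite pac pbc pc) (simp add: p_def)
qed

lemma H_Pair_subadditive:
  assumes "label X" "label Y"
  shows "H (\<lambda>x. (X x, Y x)) \<le> H X + H Y"
proof -
  have "H (\<lambda>x. (X x, Y x)) = H (\<lambda>x. (X x, Y x, ()))"
    "H (\<lambda>x. (X x, ())) = H X" "H (\<lambda>x. (Y x, ())) = H Y"
    by (intro H_cong; simp)+
  then show ?thesis
    using H_submodular[OF assms label_const[of "()"]] H_const[of "()"] by simp
qed

text \<open>
  Each \<open>W k\<close> is predicted by the function \<open>g k\<close> of \<open>Z\<close> with conditional entropy at most \<open>e\<close>. By
  submodularity, joining \<open>W k\<close> to a tuple that already contains \<open>Z\<close> costs no more.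
\<close>

lemma H_map_upt_le:
  assumes Z: "label Z" and W: "\<And>k. k < K \<Longrightarrow> label (W k)"
    and close: "\<And>k. k < K \<Longrightarrow> H (\<lambda>x. (W k x, g k (Z x))) - H (\<lambda>x. g k (Z x)) \<le> e"
  shows "H (\<lambda>x. map (\<lambda>k. W k x) [0..<K]) \<le> H Z + real K * e"
proof -
  have "H (\<lambda>x. (map (\<lambda>k. W k x) [0..<K], Z x)) \<le> H Z + real K * e"
    using W close
  proof (induction K)
    case 0
    have "H (\<lambda>x. (map (\<lambda>k. W k x) [0..<0], Z x)) = H Z"
      by (rule H_cong) simp
    then show ?case by simp
  next
    case (Suc K)
    let ?B = "\<lambda>x. (map (\<lambda>k. W k x) [0..<K], Z x)" and ?Y = "\<lambda>x. g K (Z x)"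
    have lab: "label ?B" "label ?Y" "label (W K)"
      using Suc.prems(1) label_Pair[OF label_map_upt[of K W] Z] label_comp[OF Z, of "g K"]
      by simp_all
    have "H (\<lambda>x. (map (\<lambda>k. W k x) [0..<Suc K], Z x)) = H (\<lambda>x. (W K x, ?B x, ?Y x))"
      by (rule H_cong) auto
    moreover have "H (\<lambda>x. (?B x, ?Y x)) = H ?B"
      by (rule H_cong) auto
    ultimately have "H (\<lambda>x. (map (\<lambda>k. W k x) [0..<Suc K], Z x))
        \<le> H ?B + (H (\<lambda>x. (W K x, ?Y x)) - H ?Y)"
      using H_submodular[OF lab(3,1,2)] by simp
    moreover have "H ?B \<le> H Z + real K * e"
      using Suc by simp
    ultimately show ?case
      using Suc.prems(2)[of K] by (simp add: algebra_simps)
  qed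
  moreover have "H (\<lambda>x. map (\<lambda>k. W k x) [0..<K]) \<le> H (\<lambda>x. (map (\<lambda>k. W k x) [0..<K], Z x))"
    by (rule H_le_Pair[OF label_map_upt[OF W] Z])
  ultimately show ?thesis by simp
qed

lemma finite_measurable_partition_level_sets:
  assumes "label X"
  shows "finite_measurable_partition M (level_sets X)"
  unfolding finite_measurable_partition_def
proof (intro conjI)
  show "finite (level_sets X)" "level_sets X \<subseteq> sets M"
    using assms by (auto simp: level_sets_eq_image label_def)
  show "partition_on (space M) (level_sets X)"
    by (rule partition_onI) (auto simp: space_eq_UNIV level_sets_def disjnt_def)
qed

lemma finite_measurable_partitionE:
  assumes "finite_measurable_partition M P"
  obtains X :: "'a \<Rightarrow> 'a set" where "label X" "P = level_sets X"
proof -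
  have P: "finite P" "P \<subseteq> sets M" "\<Union>P = UNIV" "disjoint P" "{} \<notin> P"
    using assms by (auto simp: finite_measurable_partition_def partition_on_def space_eq_UNIV)
  define X where "X x = (THE A. A \<in> P \<and> x \<in> A)" for x
  have X: "X x = A" if "A \<in> P" "x \<in> A" for x A
    unfolding X_def using that P(4) by (intro the_equality) (auto simp: disjoint_def)
  have ran: "range X = P"
  proof (intro equalityI subsetI)
    fix A assume "A \<in> range X"
    then obtain x where "A = X x" by auto
    moreover obtain B where "B \<in> P" "x \<in> B" using P(3) by blast
    ultimately show "A \<in> P" using X by simp
  next
    fix A assume A: "A \<in> P"
    then obtain x where "x \<in> A" using P(5) by (metis all_not_in_conv)
    then show "A \<in> range X" using X[OF A] by blast
  qed
  have vim: "X -` {A} = A" if "A \<in> P" for A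
  proof (intro equalityI subsetI)
    fix x assume "x \<in> X -` {A}"
    moreover obtain B where "B \<in> P" "x \<in> B" using P(3) by blast
    ultimately show "x \<in> A" using X by auto
  qed (use X that in auto)
  have "X -` {A} = {}" if "A \<notin> P" for A
    using ran that by blast
  then have "label X"
    using P ran vim by (auto simp: label_def) (metis sets.empty_sets subsetD)
  moreover have "level_sets X = P"
    using ran vim by (auto simp: level_sets_eq_image)
  ultimately show ?thesis using that by blast
qed

lemma metric_entropy_partition_level_sets:
  "metric_entropy_partition M f (level_sets X) = lim (\<lambda>n. H (itinerary f X n) / real n)"
  by (simp add: metric_entropy_partition_def dynamical_join_level_sets space_eq_UNIV)

lemma convergent_itinerary_entropy:
  assumes X: "label X" and f: "preserves f"
  shows "convergent (\<lambda>n. H (itinerary f X n) / real n)"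
proof (rule subadditive_imp_convergent)
  fix m n
  have "H (itinerary f X (m + n)) = H (\<lambda>x. (itinerary f X m x, itinerary f X n ((f ^^ m) x)))"
  proof (rule H_cong)
    fix x y
    have "(\<forall>i<m + n. P i) \<longleftrightarrow> (\<forall>i<m. P i) \<and> (\<forall>i<n. P (i + m))" for P :: "nat \<Rightarrow> bool"
    proof (intro iffI conjI allI impI)
      fix i assume *: "(\<forall>i<m. P i) \<and> (\<forall>i<n. P (i + m))" "i < m + n"
      show "P i"
      proof (cases "i < m")
        case False
        then have "P (i - m + m)" using * by (intro *(1)[THEN conjunct2, rule_format]) simp
        with False show ?thesis by simp
      qed (use * in simp)
    qed simp_all
    moreover have "(f ^^ i) ((f ^^ m) x) = (f ^^ (i + m)) x" for i x
      by (simp add: funpow_add)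
    ultimately show "itinerary f X (m + n) x = itinerary f X (m + n) y \<longleftrightarrow>
        (itinerary f X m x, itinerary f X n ((f ^^ m) x))
          = (itinerary f X m y, itinerary f X n ((f ^^ m) y))"
      by (simp add: itinerary_eq_iff)
  qed
  also have "\<dots> \<le> H (itinerary f X m) + H (\<lambda>x. itinerary f X n ((f ^^ m) x))"
    by (rule H_Pair_subadditive[OF label_itinerary[OF X f]
        label_preserves[OF label_itinerary[OF X f] preserves_funpow[OF f]]])
  also have "H (\<lambda>x. itinerary f X n ((f ^^ m) x)) = H (itinerary f X n)"
    by (rule H_preserves[OF label_itinerary[OF X f] preserves_funpow[OF f]])
  finally show "H (itinerary f X (m + n)) \<le> H (itinerary f X m) + H (itinerary f X n)" .
qed (rule H_nonneg)

lemma itinerary_entropy_tendsto: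
  assumes "label X" "preserves f"
  shows "(\<lambda>n. H (itinerary f X n) / real n) \<longlonglongrightarrow> metric_entropy_partition M f (level_sets X)"
  using convergent_itinerary_entropy[OF assms]
  by (simp add: metric_entropy_partition_level_sets convergent_LIMSEQ_iff)

lemma metric_entropy_ge:
  assumes "label X"
  shows "ereal (metric_entropy_partition M f (level_sets X)) \<le> metric_entropy M f"
  unfolding metric_entropy_def
  by (rule SUP_upper) (simp add: finite_measurable_partition_level_sets assms)

text \<open>
  An itinerary of length \<open>n\<close> under \<open>f ^^ m\<close> of itineraries of length \<open>m\<close> under \<open>f\<close> carries the
  same information as one itinerary of length \<open>m * n\<close> under \<open>f\<close>.
\<close>

lemma metric_entropy_power_ge:
  assumes X: "label X" and f: "preserves f"
  shows "ereal (real m * metric_entropy_partition M f (level_sets X)) \<le> metric_entropy M (f ^^ m)"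
proof (cases "m = 0")
  case True
  \<comment> \<open>Here the claim is that metric entropy is nonnegative; the trivial partition shows this.\<close>
  have "(\<lambda>n. H (itinerary (f ^^ 0) (\<lambda>_. ()) n) / real n)
      \<longlonglongrightarrow> metric_entropy_partition M (f ^^ 0) (level_sets (\<lambda>_. ()))"
    by (intro itinerary_entropy_tendsto label_const preserves_funpow f)
  moreover have "0 \<le> H (itinerary (f ^^ 0) (\<lambda>_. ()) n) / real n" for n
    by (simp add: H_nonneg)
  ultimately have "0 \<le> metric_entropy_partition M (f ^^ 0) (level_sets (\<lambda>_. ()))"
    by (intro LIMSEQ_le_const) auto
  then show ?thesis
    using metric_entropy_ge[OF label_const[of "()"], of "f ^^ 0"] True
    by (simp add: order_trans[rotated] zero_ereal_def)
next
  case m: False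
  have eq: "H (itinerary (f ^^ m) (itinerary f X m) n) = H (itinerary f X (m * n))" for n
  proof (rule H_cong)
    fix x y
    have "(\<forall>i<n. \<forall>j<m. P (j + i * m)) \<longleftrightarrow> (\<forall>k<m * n. P k)" for P :: "nat \<Rightarrow> bool"
    proof (intro iffI allI impI)
      fix k assume *: "\<forall>i<n. \<forall>j<m. P (j + i * m)" "k < m * n"
      then have "k div m < n" "k mod m < m"
        using m by (simp_all add: less_mult_imp_div_less mult.commute)
      with * have "P (k mod m + k div m * m)" by blast
      then show "P k" by simp
    next
      fix i j assume *: "\<forall>k<m * n. P k" "i < n" "j < m"
      have "j + i * m < Suc i * m" using *(3) by simp
      also have "\<dots> \<le> n * m" using *(2) by (intro mult_right_mono) auto
      finally show "P (j + i * m)" using *(1) by (simp add: mult.commute)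
    qed
    moreover have "(f ^^ j) (((f ^^ m) ^^ i) x) = (f ^^ (j + i * m)) x" for i j x
      by (simp add: funpow_add funpow_mult mult.commute)
    ultimately show "itinerary (f ^^ m) (itinerary f X m) n x = itinerary (f ^^ m) (itinerary f X m) n y
        \<longleftrightarrow> itinerary f X (m * n) x = itinerary f X (m * n) y"
      by (simp add: itinerary_eq_iff)
  qed
  have "strict_mono (\<lambda>n. m * n)" using m by (intro strict_monoI) simp
  from LIMSEQ_subseq_LIMSEQ[OF itinerary_entropy_tendsto[OF X f] this]
  have "(\<lambda>n. real m * (H (itinerary f X (m * n)) / real (m * n)))
      \<longlonglongrightarrow> real m * metric_entropy_partition M f (level_sets X)"
    by (intro tendsto_mult_left) (simp add: comp_def)
  moreover have "real m * (H (itinerary f X (m * n)) / real (m * n))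
      = H (itinerary (f ^^ m) (itinerary f X m) n) / real n" for n
    using m by (simp add: eq)
  ultimately have "(\<lambda>n. H (itinerary (f ^^ m) (itinerary f X m) n) / real n)
      \<longlonglongrightarrow> real m * metric_entropy_partition M f (level_sets X)"
    by simp
  then have "metric_entropy_partition M (f ^^ m) (level_sets (itinerary f X m))
      = real m * metric_entropy_partition M f (level_sets X)"
    by (rule LIMSEQ_unique[OF itinerary_entropy_tendsto[OF label_itinerary[OF X f] preserves_funpow[OF f]]])
  then show ?thesis
    using metric_entropy_ge[OF label_itinerary[OF X f], of "f ^^ m" m] by simp
qed

end

section \<open>Metric entropy of the maps of a flow\<close>

lemma continuous_on_x_ln_x: "continuous_on {0..} (\<lambda>x::real. x * ln x)"
  unfolding continuous_on_def
proof
  fix x :: real assume "x \<in> {0..}"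
  show "((\<lambda>x. x * ln x) \<longlongrightarrow> x * ln x) (at x within {0..})"
  proof (cases "x = 0")
    case True
    have "((\<lambda>x::real. x * ln x) \<longlongrightarrow> 0) (at_right 0)" by real_asymp
    then show ?thesis using True by (simp add: at_within_Ici_at_right)
  next
    case False
    then show ?thesis using \<open>x \<in> {0..}\<close> by (auto intro!: tendsto_intros)
  qed
qed

locale topological_flow =
  fixes \<Phi> :: "real \<Rightarrow> 'a::metric_space \<Rightarrow> 'a"
  assumes flow: "continuous_flow \<Phi>"
begin

lemma flow_0: "\<Phi> 0 x = x"
  using flow by (simp add: continuous_flow_def)

lemma flow_add: "\<Phi> s (\<Phi> t x) = \<Phi> (s + t) x"
  using flow by (simp add: continuous_flow_def)

lemma flow_minus: "\<Phi> (- t) (\<Phi> t x) = x" "\<Phi> t (\<Phi> (- t) x) = x"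
  by (simp_all add: flow_add flow_0)

lemma flow_funpow: "\<Phi> t ^^ n = \<Phi> (real n * t)"
proof (induction n)
  case 0
  show ?case by (simp add: fun_eq_iff flow_0)
next
  case (Suc n)
  then show ?case by (simp add: fun_eq_iff flow_add algebra_simps)
qed

lemma continuous_on_flow:
  assumes "continuous_on S f" "continuous_on S g"
  shows "continuous_on S (\<lambda>z. \<Phi> (f z) (g z))"
proof -
  have "continuous_on UNIV (\<lambda>z. \<Phi> (fst z) (snd z))"
    using flow by (simp add: continuous_flow_def case_prod_beta')
  then have "continuous_on S (\<lambda>z. (\<lambda>z. \<Phi> (fst z) (snd z)) (f z, g z))"
    by (rule continuous_on_compose2) (auto intro!: continuous_on_Pair assms)
  then show ?thesis by simp
qed

lemma continuous_on_flow_map: "continuous_on S (\<Phi> t)"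
  by (rule continuous_on_flow) (auto intro: continuous_intros)

lemma surj_flow_map: "surj (\<Phi> t)"
  by (metis flow_minus(2) surjI)

end

locale invariant_flow = topological_flow \<Phi> + prob_space M
  for \<Phi> :: "real \<Rightarrow> 'a::metric_space \<Rightarrow> 'a" and M :: "'a measure" +
  assumes sets_eq_borel: "sets M = sets borel"
    and invariant: "distr M borel (\<Phi> t) = M"
begin

sublocale full_prob_space M
  using sets_eq_imp_space_eq[OF sets_eq_borel] by unfold_locales simp

lemma borel_measurable_M: "continuous_on UNIV f \<Longrightarrow> f \<in> borel_measurable M"
  using borel_measurable_continuous_onI measurable_cong_sets[OF sets_eq_borel refl] by blast

lemma preserves_flow: "preserves (\<Phi> t)"
  unfolding preserves_def
proof (intro ballI conjI)
  fix A assume A: "A \<in> sets M"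
  have meas: "\<Phi> t \<in> borel_measurable M"
    by (intro borel_measurable_M continuous_on_flow_map)
  from measurable_sets[OF this, of A] A show "\<Phi> t -` A \<in> sets M"
    by (simp add: sets_eq_borel space_eq_UNIV)
  have "prob A = measure (distr M borel (\<Phi> t)) A"
    by (simp add: invariant)
  also have "\<dots> = prob (\<Phi> t -` A)"
    using A meas by (simp add: measure_distr sets_eq_borel space_eq_UNIV)
  finally show "prob (\<Phi> t -` A) = prob A" ..
qed

lemma prob_vimage_flow: "A \<in> sets M \<Longrightarrow> prob (\<Phi> t -` A) = prob A"
  and sets_vimage_flow: "A \<in> sets M \<Longrightarrow> \<Phi> t -` A \<in> sets M"
  using preserves_flow by (auto simp: preserves_def)

lemma prob_vimage_Diff:
  assumes "A \<in> sets M"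
  shows "prob (\<Phi> s -` A - A) = prob (A - \<Phi> s -` A)"
  using finite_measure_Diff'[of A "\<Phi> s -` A"] finite_measure_Diff'[of "\<Phi> s -` A" A] assms
  by (simp add: prob_vimage_flow sets_vimage_flow Int_commute)

text \<open>
  A point of an open set stays in it for small times, so the indicators converge pointwise.
\<close>

lemma prob_open_Diff_vimage_tendsto_0:
  assumes "open A"
  shows "((\<lambda>s. prob (A - \<Phi> s -` A)) \<longlongrightarrow> 0) (at 0)"
  unfolding tendsto_at_iff_sequentially comp_def
proof (intro allI impI)
  fix s :: "nat \<Rightarrow> real" assume s: "s \<longlonglongrightarrow> 0"
  have A: "A \<in> sets M" using assms by (simp add: sets_eq_borel)
  have "(\<lambda>n. \<integral>x. indicator (A - \<Phi> (s n) -` A) x \<partial>M) \<longlonglongrightarrow> (\<integral>x. 0 \<partial>M :: real)"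
  proof (rule integral_dominated_convergence[where w = "\<lambda>_. 1"])
    show "AE x in M. (\<lambda>n. indicator (A - \<Phi> (s n) -` A) x :: real) \<longlonglongrightarrow> 0"
    proof (rule AE_I2)
      fix x
      have "continuous_on UNIV (\<lambda>t. \<Phi> t x)"
        by (intro continuous_on_flow continuous_intros)
      then have lim: "(\<lambda>n. \<Phi> (s n) x) \<longlonglongrightarrow> x"
        using continuous_on_tendsto_compose[OF _ s] by (fastforce simp: flow_0)
      show "(\<lambda>n. indicator (A - \<Phi> (s n) -` A) x :: real) \<longlonglongrightarrow> 0"
      proof (cases "x \<in> A")
        case True
        then have "\<forall>\<^sub>F n in sequentially. \<Phi> (s n) x \<in> A"
          using lim assms by (simp add: topological_tendstoD)
        then have "\<forall>\<^sub>F n in sequentially. indicator (A - \<Phi> (s n) -` A) x = (0::real)"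
          by eventually_elim simp
        then show ?thesis by (rule tendsto_eventually)
      qed simp
    qed
  qed (use A sets_vimage_flow in auto)
  then show "(\<lambda>n. prob (A - \<Phi> (s n) -` A)) \<longlonglongrightarrow> 0"
    using A sets_vimage_flow by simp
qed

text \<open>
  The flow acts continuously on the measure algebra. Invariance makes the two halves of the symmetric
  difference equally large, so the property passes to complements.
\<close>

lemma prob_Diff_vimage_tendsto_0:
  assumes "A \<in> sets M"
  shows "((\<lambda>s. prob (A - \<Phi> s -` A)) \<longlongrightarrow> 0) (at 0)"
proof -
  have "A \<in> sigma_sets UNIV {S. open S}"
    using assms by (simp add: sets_eq_borel sets_borel)
  then show ?thesis
  proof (induction A rule: sigma_sets.induct)
    case (Basic a)
    then show ?case by (simp add: prob_open_Diff_vimage_tendsto_0)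
  next
    case Empty
    show ?case by simp
  next
    case (Compl a)
    then have "a \<in> sets M" by (simp add: sets_eq_borel sets_borel)
    moreover have "(UNIV - a) - \<Phi> s -` (UNIV - a) = \<Phi> s -` a - a" for s by auto
    ultimately show ?case using Compl.IH by (simp add: prob_vimage_Diff)
  next
    case (Union a)
    then have a: "a i \<in> sets M" for i by (simp add: sets_eq_borel sets_borel)
    \<comment> \<open>The tail of the union has small measure, so finitely many of the sets decide.\<close>
    define B where "B n = (\<Union>i. a i) - (\<Union>i<n. a i)" for n
    have B: "B n \<in> sets M" for n unfolding B_def using a by auto
    have "(\<lambda>n. prob (B n)) \<longlonglongrightarrow> prob (\<Inter>n. B n)"
      using B by (intro finite_Lim_measure_decseq) (auto simp: B_def decseq_def)
    also have "(\<Inter>n. B n) = {}" by (auto simp: B_def)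
    finally have B0: "(\<lambda>n. prob (B n)) \<longlonglongrightarrow> 0" by simp
    show ?case
    proof (rule order_tendstoI)
      fix l :: real assume "l < 0"
      then have "l < prob ((\<Union>i. a i) - \<Phi> s -` (\<Union>i. a i))" for s
        by (rule less_le_trans) (rule measure_nonneg)
      then show "\<forall>\<^sub>F s in at 0. l < prob ((\<Union>i. a i) - \<Phi> s -` (\<Union>i. a i))" by simp
    next
      fix u :: real assume u: "0 < u"
      obtain n where n: "prob (B n) < u"
        using order_tendstoD(2)[OF B0 u] eventually_sequentially by auto
      have "((\<lambda>s. prob (B n) + (\<Sum>i<n. prob (a i - \<Phi> s -` a i))) \<longlongrightarrow> prob (B n) + (\<Sum>i<n. 0)) (at 0)"
        using Union.IH by (intro tendsto_intros)
      then have "\<forall>\<^sub>F s in at 0. prob (B n) + (\<Sum>i<n. prob (a i - \<Phi> s -` a i)) < u"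
        using n by (intro order_tendstoD) auto
      then show "\<forall>\<^sub>F s in at 0. prob ((\<Union>i. a i) - \<Phi> s -` (\<Union>i. a i)) < u"
      proof eventually_elim
        case (elim s)
        have "prob ((\<Union>i. a i) - \<Phi> s -` (\<Union>i. a i)) \<le> prob (B n \<union> (\<Union>i<n. a i - \<Phi> s -` a i))"
          using a B sets_vimage_flow by (intro finite_measure_mono) (auto simp: B_def)
        also have "\<dots> \<le> prob (B n) + prob (\<Union>i<n. a i - \<Phi> s -` a i)"
          using a B sets_vimage_flow by (intro measure_Un_le) auto
        also have "prob (\<Union>i<n. a i - \<Phi> s -` a i) \<le> (\<Sum>i<n. prob (a i - \<Phi> s -` a i))"
          using a sets_vimage_flow by (intro finite_measure_subadditive_finite) auto
        finally show ?case using elim by simp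
      qed
    qed
  qed
qed

text \<open>
  As \<open>s\<close> tends to \<open>0\<close>, the joint law of \<open>X \<circ> \<Phi> s\<close> and \<open>X\<close> concentrates on the diagonal, and
  \<open>x ln x\<close> is continuous on the nonnegative reals, including \<open>0\<close>.
\<close>

lemma H_flow_Pair_tendsto:
  assumes X: "label X"
  shows "((\<lambda>s. H (\<lambda>x. (X (\<Phi> s x), X x))) \<longlongrightarrow> H X) (at 0)"
proof -
  define p where "p s u v = prob {x. X (\<Phi> s x) = u \<and> X x = v}" for s u v
  have rng: "range (\<lambda>x. X (\<Phi> s x)) = range X" for s
    using surj_flow_map[of s] by (metis image_image)
  have H: "H (\<lambda>x. (X (\<Phi> s x), X x)) = - (\<Sum>u\<in>range X. \<Sum>v\<in>range X. p s u v * ln (p s u v))" for s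
    using H_Pair_eq_sum[OF label_preserves[OF X preserves_flow] X] unfolding rng by (simp add: p_def)
  have lim: "((\<lambda>s. p s u v) \<longlongrightarrow> (if u = v then prob (X -` {u}) else 0)) (at 0)" for u v
  proof -
    let ?A = "X -` {u}"
    have A: "?A \<in> sets M" "\<Phi> s -` ?A \<in> sets M" for s
      using X by (auto intro: label_sets sets_vimage_flow)
    have Dlim: "((\<lambda>s. prob (?A - \<Phi> s -` ?A)) \<longlongrightarrow> 0) (at 0)"
      by (rule prob_Diff_vimage_tendsto_0[OF A(1)])
    show ?thesis
    proof (cases "u = v")
      case True
      have "p s u v = prob ?A - prob (?A - \<Phi> s -` ?A)" for s
      proof -
        have "{x. X (\<Phi> s x) = u \<and> X x = v} = ?A \<inter> \<Phi> s -` ?A" using True by auto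
        then show ?thesis using finite_measure_Diff'[OF A] by (simp add: p_def)
      qed
      moreover have "((\<lambda>s. prob ?A - prob (?A - \<Phi> s -` ?A)) \<longlongrightarrow> prob ?A - 0) (at 0)"
        by (intro tendsto_intros Dlim)
      ultimately show ?thesis using True by simp
    next
      case False
      have "p s u v \<le> prob (?A - \<Phi> s -` ?A)" for s
        unfolding p_def prob_vimage_Diff[OF A(1), symmetric]
        using A False by (intro finite_measure_mono) auto
      then show ?thesis
        using False by (auto intro!: tendsto_sandwich[OF _ _ tendsto_const Dlim] simp: p_def)
    qed
  qed
  have "((\<lambda>s. - (\<Sum>u\<in>range X. \<Sum>v\<in>range X. p s u v * ln (p s u v))) \<longlongrightarrow>
    - (\<Sum>u\<in>range X. \<Sum>v\<in>range X. (if u = v then prob (X -` {u}) else 0)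
        * ln (if u = v then prob (X -` {u}) else 0))) (at 0)"
    by (intro tendsto_minus tendsto_sum continuous_on_tendsto_compose[OF continuous_on_x_ln_x lim])
      (auto simp: p_def)
  also have "(\<Sum>u\<in>range X. \<Sum>v\<in>range X. (if u = v then prob (X -` {u}) else 0)
        * ln (if u = v then prob (X -` {u}) else 0))
      = (\<Sum>u\<in>range X. \<Sum>v\<in>range X. if u = v then prob (X -` {u}) * ln (prob (X -` {u})) else 0)"
    by (intro sum.cong refl) auto
  also have "- \<dots> = H X"
    using label_finite[OF X] by (simp add: H_eq_sum[of "range X"] sum.delta')
  finally show ?thesis by (simp add: H)
qed

text \<open>
  The value of \<open>X\<close> at the integer time \<open>k\<close> is predicted by its value at the last multiple of \<open>\<sigma>\<close> not
  exceeding \<open>k\<close>. Invariance moves that multiple to time \<open>0\<close>, where the hypothesis applies.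
\<close>

lemma itinerary_entropy_sampling_le:
  assumes X: "label X" and \<sigma>: "\<sigma> > 0"
    and close: "\<And>s. \<bar>s\<bar> < \<sigma> \<Longrightarrow> H (\<lambda>x. (X (\<Phi> s x), X x)) \<le> H X + e"
  shows "H (itinerary (\<Phi> 1) X K)
    \<le> H (itinerary (\<Phi> \<sigma>) X (nat \<lfloor>real K / \<sigma>\<rfloor> + 1)) + real K * e"
proof -
  define N where "N = nat \<lfloor>real K / \<sigma>\<rfloor> + 1"
  define i where "i k = nat \<lfloor>real k / \<sigma>\<rfloor>" for k
  have i: "\<bar>real k - real (i k) * \<sigma>\<bar> < \<sigma>" for k
  proof -
    have "real (i k) = of_int \<lfloor>real k / \<sigma>\<rfloor>" using \<sigma> by (simp add: i_def)
    then have "real (i k) \<le> real k / \<sigma>" "real k / \<sigma> < real (i k) + 1" by linarith+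
    then show ?thesis using \<sigma> by (simp add: field_simps abs_if)
  qed
  have iN: "i k < N" if "k < K" for k
  proof -
    have "\<lfloor>real k / \<sigma>\<rfloor> \<le> \<lfloor>real K / \<sigma>\<rfloor>"
      using that \<sigma> by (intro floor_mono divide_right_mono) auto
    then show ?thesis by (simp add: i_def N_def le_imp_less_Suc nat_mono)
  qed
  have Z: "itinerary (\<Phi> \<sigma>) X N x ! i k = X (\<Phi> (real (i k) * \<sigma>) x)" if "k < K" for k x
    using iN[OF that] by (simp add: itinerary_def flow_funpow)
  have W: "itinerary (\<Phi> 1) X K = (\<lambda>x. map (\<lambda>k. X (\<Phi> (real k) x)) [0..<K])"
    by (simp add: fun_eq_iff itinerary_def flow_funpow)
  have "H (\<lambda>x. map (\<lambda>k. X (\<Phi> (real k) x)) [0..<K]) \<le> H (itinerary (\<Phi> \<sigma>) X N) + real K * e"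
  proof (rule H_map_upt_le[where g = "\<lambda>k z. z ! i k"])
    show "label (itinerary (\<Phi> \<sigma>) X N)"
      by (rule label_itinerary[OF X preserves_flow])
    show "label (\<lambda>x. X (\<Phi> (real k) x))" for k
      by (rule label_preserves[OF X preserves_flow])
    fix k assume k: "k < K"
    let ?s = "real k - real (i k) * \<sigma>"
    let ?W = "\<lambda>x. (X (\<Phi> ?s x), X x)"
    have "H (\<lambda>x. (X (\<Phi> (real k) x), itinerary (\<Phi> \<sigma>) X N x ! i k))
        = H (\<lambda>x. ?W (\<Phi> (real (i k) * \<sigma>) x))"
      by (simp add: Z[OF k] flow_add)
    also have "\<dots> = H ?W"
      by (rule H_preserves[OF label_Pair[OF label_preserves[OF X preserves_flow] X] preserves_flow])
    also have "\<dots> \<le> H X + e" by (rule close[OF i])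
    also have "H X = H (\<lambda>x. itinerary (\<Phi> \<sigma>) X N x ! i k)"
      unfolding Z[OF k] by (rule H_preserves[OF X preserves_flow, symmetric])
    finally show "H (\<lambda>x. (X (\<Phi> (real k) x), itinerary (\<Phi> \<sigma>) X N x ! i k))
        - H (\<lambda>x. itinerary (\<Phi> \<sigma>) X N x ! i k) \<le> e" by simp
  qed
  then show ?thesis by (simp add: W N_def)
qed

lemma metric_entropy_partition_sampling_le:
  assumes X: "label X" and \<sigma>: "\<sigma> > 0"
    and close: "\<And>s. \<bar>s\<bar> < \<sigma> \<Longrightarrow> H (\<lambda>x. (X (\<Phi> s x), X x)) \<le> H X + e"
  shows "metric_entropy_partition M (\<Phi> 1) (level_sets X)
    \<le> metric_entropy_partition M (\<Phi> \<sigma>) (level_sets X) / \<sigma> + e"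
proof -
  define N where "N K = nat \<lfloor>real K / \<sigma>\<rfloor> + 1" for K :: nat
  have "filterlim N at_top sequentially"
    unfolding N_def using \<sigma> by real_asymp
  then have "(\<lambda>K. H (itinerary (\<Phi> \<sigma>) X (N K)) / real (N K))
      \<longlonglongrightarrow> metric_entropy_partition M (\<Phi> \<sigma>) (level_sets X)"
    by (rule filterlim_compose[OF itinerary_entropy_tendsto[OF X preserves_flow]])
  moreover have "(\<lambda>K. real (N K) / real K) \<longlonglongrightarrow> 1 / \<sigma>"
    unfolding N_def using \<sigma> by (real_asymp simp: inverse_eq_divide)
  ultimately have "(\<lambda>K. H (itinerary (\<Phi> \<sigma>) X (N K)) / real (N K) * (real (N K) / real K) + e)
      \<longlonglongrightarrow> metric_entropy_partition M (\<Phi> \<sigma>) (level_sets X) * (1 / \<sigma>) + e"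
    by (intro tendsto_add tendsto_mult tendsto_const)
  moreover have "\<forall>\<^sub>F K in sequentially. H (itinerary (\<Phi> 1) X K) / real K
      \<le> H (itinerary (\<Phi> \<sigma>) X (N K)) / real (N K) * (real (N K) / real K) + e"
    using eventually_gt_at_top[of 0]
  proof eventually_elim
    case (elim K)
    have "N K \<noteq> 0" by (simp add: N_def)
    then have "H (itinerary (\<Phi> \<sigma>) X (N K)) / real (N K) * (real (N K) / real K) + e
        = (H (itinerary (\<Phi> \<sigma>) X (N K)) + real K * e) / real K"
      using elim by (simp add: field_simps)
    moreover have "H (itinerary (\<Phi> 1) X K) \<le> H (itinerary (\<Phi> \<sigma>) X (N K)) + real K * e"
      unfolding N_def by (rule itinerary_entropy_sampling_le[OF assms])
    ultimately show ?case
      by (simp add: divide_right_mono)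
  qed
  ultimately show ?thesis
    using tendsto_le[OF trivial_limit_sequentially _ itinerary_entropy_tendsto[OF X preserves_flow]]
    by simp
qed

text \<open>
  One half of Abramov's formula. The time \<open>\<tau>\<close> is divided into \<open>m\<close> steps \<open>\<sigma>\<close> so short that moving
  a given partition by less than \<open>\<sigma>\<close> adds at most \<open>e\<close> to its entropy.
\<close>

lemma time_scaled_metric_entropy_le:
  assumes \<tau>: "\<tau> > 0"
  shows "metric_entropy M (\<Phi> 1) \<le> metric_entropy M (\<Phi> \<tau>) / ereal \<tau>"
  unfolding metric_entropy_def[of M "\<Phi> 1"]
proof (rule SUP_least)
  fix P assume "P \<in> {P. finite_measurable_partition M P}"
  then obtain X :: "'a \<Rightarrow> 'a set" where X: "label X" and P: "P = level_sets X"
    using finite_measurable_partitionE by blast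
  have approx: "ereal (metric_entropy_partition M (\<Phi> 1) P) \<le> metric_entropy M (\<Phi> \<tau>) / ereal \<tau> + ereal e"
    if e: "e > 0" for e :: real
  proof -
    have "\<forall>\<^sub>F s in at 0. H (\<lambda>x. (X (\<Phi> s x), X x)) < H X + e"
      using e by (intro order_tendstoD[OF H_flow_Pair_tendsto[OF X]]) simp
    then obtain \<delta> where \<delta>: "\<delta> > 0"
      "\<And>s. s \<noteq> 0 \<Longrightarrow> \<bar>s\<bar> < \<delta> \<Longrightarrow> H (\<lambda>x. (X (\<Phi> s x), X x)) < H X + e"
      by (auto simp: eventually_at)
    have "H (\<lambda>x. (X (\<Phi> 0 x), X x)) = H X"
      by (rule H_cong) (simp add: flow_0)
    with \<delta>(2) e have close: "H (\<lambda>x. (X (\<Phi> s x), X x)) \<le> H X + e" if "\<bar>s\<bar> < \<delta>" for s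
      using that by (cases "s = 0") (auto simp: less_imp_le)
    define m where "m = nat \<lceil>\<tau> / \<delta>\<rceil>"
    define \<sigma> where "\<sigma> = \<tau> / real m"
    have m: "m > 0" "\<tau> / \<delta> \<le> real m"
      using \<tau> \<delta>(1) by (auto simp: m_def real_nat_ceiling_ge)
    have \<sigma>: "\<sigma> > 0" "\<sigma> \<le> \<delta>" "real m * \<sigma> = \<tau>"
      using m \<tau> \<delta>(1) by (auto simp: \<sigma>_def field_simps)
    have "ereal (\<tau> * (metric_entropy_partition M (\<Phi> 1) P - e))
        \<le> ereal (real m * metric_entropy_partition M (\<Phi> \<sigma>) P)"
    proof -
      have "metric_entropy_partition M (\<Phi> 1) P - e \<le> metric_entropy_partition M (\<Phi> \<sigma>) P / \<sigma>"
        using metric_entropy_partition_sampling_le[OF X \<sigma>(1), of e] close \<sigma>(2) by (simp add: P)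
      then have "\<tau> * (metric_entropy_partition M (\<Phi> 1) P - e)
          \<le> \<tau> * (metric_entropy_partition M (\<Phi> \<sigma>) P / \<sigma>)"
        using \<tau> by (intro mult_left_mono) auto
      also have "\<dots> = real m * metric_entropy_partition M (\<Phi> \<sigma>) P"
        using \<sigma>(1) by (simp add: \<sigma>(3)[symmetric])
      finally show ?thesis by simp
    qed
    also have "\<dots> \<le> metric_entropy M (\<Phi> \<tau>)"
      using metric_entropy_power_ge[OF X preserves_flow, of m \<sigma>] \<sigma>(3) by (simp add: P flow_funpow)
    finally have "ereal (metric_entropy_partition M (\<Phi> 1) P - e) \<le> metric_entropy M (\<Phi> \<tau>) / ereal \<tau>"
      using \<tau> by (simp add: ereal_le_divide_pos)
    then show ?thesis
      by (cases "metric_entropy M (\<Phi> \<tau>) / ereal \<tau>") auto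
  qed
  then show "ereal (metric_entropy_partition M (\<Phi> 1) P) \<le> metric_entropy M (\<Phi> \<tau>) / ereal \<tau>"
    by (rule ereal_le_epsilon2)
qed

end

section \<open>Topological entropy of subsets\<close>

lemma exit_weight_nonneg: "0 \<le> exit_weight N B"
  by (simp add: exit_weight_def)

lemma entropy_outer_measure_eq_0_iff:
  "entropy_outer_measure N Y \<alpha> = 0 \<longleftrightarrow> (\<forall>\<epsilon>>0. fine_cover_inf N Y \<alpha> \<epsilon> = 0)"
proof -
  have "entropy_outer_measure N Y \<alpha> \<le> 0 \<longleftrightarrow> (\<forall>\<epsilon>>0. fine_cover_inf N Y \<alpha> \<epsilon> \<le> 0)"
    by (simp only: entropy_outer_measure_eq_SUP SUP_le_iff Ball_def greaterThan_iff)
  then show ?thesis by simp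
qed

lemma fine_cover_inf_mono: "Y \<subseteq> Z \<Longrightarrow> fine_cover_inf N Y \<alpha> \<epsilon> \<le> fine_cover_inf N Z \<alpha> \<epsilon>"
  unfolding fine_cover_inf_def by (rule INF_superset_mono) auto

lemma cover_entropy_mono: "Y \<subseteq> Z \<Longrightarrow> cover_entropy N Y \<le> cover_entropy N Z"
  unfolding cover_entropy_def
  by (rule Inf_superset_mono)
    (auto simp: entropy_outer_measure_eq_0_iff; metis fine_cover_inf_mono le_zero_eq)

lemma flow_topological_entropy_mono:
  "Y \<subseteq> Z \<Longrightarrow> flow_topological_entropy \<Phi> Y \<le> flow_topological_entropy \<Phi> Z"
  unfolding flow_topological_entropy_def by (intro SUP_mono') (rule cover_entropy_mono)

text \<open>
  If weights in the second system are at most the \<open>1/t\<close>-th powers of those in the first one, the exponent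
  \<open>t\<alpha>\<close> does in the second what \<open>\<alpha>\<close> does in the first. For the maps of a flow, \<open>t\<close> is the
  length of the time step.
\<close>

lemma cover_entropy_le_scaled:
  assumes t: "t > 0"
    and weight: "\<And>B. exit_weight N' B \<le> exit_weight N B powr (1 / t)"
  shows "cover_entropy N' Y \<le> ereal t * cover_entropy N Y"
proof -
  have outer: "entropy_outer_measure N' Y (t * \<alpha>) = 0"
    if \<alpha>: "\<alpha> > 0" "entropy_outer_measure N Y \<alpha> = 0" for \<alpha>
    unfolding entropy_outer_measure_eq_0_iff
  proof (intro allI impI)
    fix \<epsilon> :: real assume \<epsilon>: "\<epsilon> > 0"
    have "fine_cover_inf N' Y (t * \<alpha>) \<epsilon> \<le> fine_cover_inf N Y \<alpha> (\<epsilon> powr t)"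
      unfolding fine_cover_inf_def
    proof (rule INF_mono)
      fix E :: "nat \<Rightarrow> 'a set" assume E: "E \<in> {E. Y \<subseteq> \<Union> (range E) \<and> (\<forall>i. exit_weight N (E i) < \<epsilon> powr t)}"
      have "exit_weight N' (E i) < \<epsilon>" for i
      proof -
        have "exit_weight N' (E i) \<le> exit_weight N (E i) powr (1 / t)" by (rule weight)
        also have "\<dots> < (\<epsilon> powr t) powr (1 / t)"
          using E t by (intro powr_less_mono2) (auto simp: exit_weight_nonneg)
        finally show ?thesis using t \<epsilon> by (simp add: powr_powr)
      qed
      moreover have "cover_sum N' (t * \<alpha>) E \<le> cover_sum N \<alpha> E"
        unfolding cover_sum_def
      proof (intro suminf_le ennreal_leI summableI)
        fix i
        have "exit_weight N' (E i) powr (t * \<alpha>) \<le> (exit_weight N (E i) powr (1 / t)) powr (t * \<alpha>)"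
          using t \<alpha> by (intro powr_mono2 weight) (auto simp: exit_weight_nonneg)
        then show "exit_weight N' (E i) powr (t * \<alpha>) \<le> exit_weight N (E i) powr \<alpha>"
          using t by (simp add: powr_powr)
      qed
      ultimately show "\<exists>E'\<in>{E. Y \<subseteq> \<Union> (range E) \<and> (\<forall>i. exit_weight N' (E i) < \<epsilon>)}.
          cover_sum N' (t * \<alpha>) E' \<le> cover_sum N \<alpha> E"
        using E by blast
    qed
    then show "fine_cover_inf N' Y (t * \<alpha>) \<epsilon> = 0"
      using \<alpha> \<epsilon> by (simp add: entropy_outer_measure_eq_0_iff)
  qed
  have "cover_entropy N' Y / ereal t \<le> cover_entropy N Y"
    unfolding cover_entropy_def[of N]
  proof (rule Inf_greatest)
    fix z assume "z \<in> {ereal \<alpha> |\<alpha>. 0 < \<alpha> \<and> entropy_outer_measure N Y \<alpha> = 0}"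
    then obtain \<alpha> where \<alpha>: "z = ereal \<alpha>" "0 < \<alpha>" "entropy_outer_measure N Y \<alpha> = 0" by auto
    have "cover_entropy N' Y \<le> ereal (t * \<alpha>)"
      unfolding cover_entropy_def by (rule Inf_lower) (use outer \<alpha> t in auto)
    then show "cover_entropy N' Y / ereal t \<le> z"
      using t \<alpha> by (simp add: ereal_divide_le_pos)
  qed
  then show ?thesis using t by (simp add: ereal_divide_le_pos)
qed

text \<open>
  The analogue of the Borel-Cantelli lemma: the union of all families from \<open>F k\<close> on is a countable cover whose
  sum is the tail of a convergent series.
\<close>

lemma entropy_outer_measure_eq_0I:
  fixes F :: "nat \<Rightarrow> 'a set set" and d :: "nat \<Rightarrow> real"
  assumes fin: "\<And>n. finite (F n)"
    and weight: "\<And>n B. B \<in> F n \<Longrightarrow> exit_weight N B \<le> d n"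
    and d: "d \<longlonglongrightarrow> 0"
    and summable: "summable (\<lambda>n. real (card (F n)) * d n powr \<alpha>)"
    and cover: "\<And>k. Y \<subseteq> (\<Union>n\<in>{k..}. \<Union>(F n))"
    and empty: "exit_weight N {} = 0"
    and \<alpha>: "\<alpha> > 0"
  shows "entropy_outer_measure N Y \<alpha> = 0"
  unfolding entropy_outer_measure_eq_0_iff
proof (intro allI impI)
  fix \<epsilon> :: real assume \<epsilon>: "\<epsilon> > 0"
  let ?a = "\<lambda>n. real (card (F n)) * d n powr \<alpha>"
  have "fine_cover_inf N Y \<alpha> \<epsilon> \<le> 0 + ennreal e" if e: "e > 0" for e
  proof -
    obtain k1 where k1: "\<And>n. n \<ge> k1 \<Longrightarrow> d n < \<epsilon>"
      using order_tendstoD(2)[OF d \<epsilon>] by (auto simp: eventually_sequentially)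
    obtain k2 where k2: "\<And>n. n \<ge> k2 \<Longrightarrow> norm (\<Sum>i. ?a (i + n)) < e"
      using suminf_exist_split[OF e summable] by auto
    define k where "k = max k1 k2"
    have "\<forall>n. \<exists>h. bij_betw h {0..<card (F n)} (F n)"
      using ex_bij_betw_nat_finite[OF fin] by blast
    then obtain h where h: "\<And>n. bij_betw (h n) {0..<card (F n)} (F n)"
      by metis
    define B where "B n j = (if j < card (F (n + k)) then h (n + k) j else {})" for n j
    have B_in: "B n j \<in> F (n + k)" if "j < card (F (n + k))" for n j
      using bij_betwE[OF h[of "n + k"]] that by (simp add: B_def)
    define E where "E i = (case prod_decode i of (n, j) \<Rightarrow> B n j)" for i
    have "Y \<subseteq> (\<Union>i. E i)"
    proof
      fix y assume "y \<in> Y"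
      then obtain n S where n: "n \<ge> k" "S \<in> F n" "y \<in> S" using cover[of k] by blast
      then have "S \<in> h n ` {0..<card (F n)}"
        using h[of n] by (simp add: bij_betw_def)
      then obtain j where "j < card (F n)" "S = h n j" by auto
      then have "E (prod_encode (n - k, j)) = S"
        using n by (simp add: E_def B_def)
      then show "y \<in> (\<Union>i. E i)" using n by blast
    qed
    moreover have "exit_weight N (E i) < \<epsilon>" for i
    proof -
      obtain n j where nj: "prod_decode i = (n, j)" by fastforce
      show ?thesis
      proof (cases "j < card (F (n + k))")
        case True
        then show ?thesis
          using weight[OF B_in] k1[of "n + k"] nj by (fastforce simp: E_def k_def)
      next
        case False
        then show ?thesis using nj \<epsilon> empty by (simp add: E_def B_def)
      qed
    qed
    ultimately have "fine_cover_inf N Y \<alpha> \<epsilon> \<le> cover_sum N \<alpha> E"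
      unfolding fine_cover_inf_def by (intro INF_lower) auto
    also have "cover_sum N \<alpha> E = (\<Sum>i. (\<lambda>(n, j). ennreal (exit_weight N (B n j) powr \<alpha>)) (prod_decode i))"
      unfolding cover_sum_def E_def by (simp add: case_prod_beta')
    also have "\<dots> = (\<Sum>n. \<Sum>j. ennreal (exit_weight N (B n j) powr \<alpha>))"
      by (rule suminf_ennreal_2dimen) simp
    also have "\<dots> \<le> (\<Sum>n. ennreal (?a (n + k)))"
    proof (intro suminf_le summableI)
      fix n
      have "(\<Sum>j. ennreal (exit_weight N (B n j) powr \<alpha>))
          = (\<Sum>j<card (F (n + k)). ennreal (exit_weight N (B n j) powr \<alpha>))"
        using \<alpha> empty by (intro suminf_finite) (auto simp: B_def)
      also have "\<dots> \<le> (\<Sum>j<card (F (n + k)). ennreal (d (n + k) powr \<alpha>))"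
        using \<alpha> weight[OF B_in] by (intro sum_mono ennreal_leI powr_mono2) (auto simp: exit_weight_nonneg)
      also have "\<dots> = ennreal (?a (n + k))"
        by (simp add: ennreal_mult ennreal_of_nat_eq_real_of_nat)
      finally show "(\<Sum>j. ennreal (exit_weight N (B n j) powr \<alpha>)) \<le> ennreal (?a (n + k))" .
    qed
    also have "\<dots> = ennreal (\<Sum>n. ?a (n + k))"
      using summable_ignore_initial_segment[OF summable, of k] by (intro suminf_ennreal2) auto
    also have "\<dots> \<le> ennreal e"
      using k2[of k] by (intro ennreal_leI) (simp add: k_def)
    finally show ?thesis by simp
  qed
  then have "fine_cover_inf N Y \<alpha> \<epsilon> \<le> 0"
    by (rule ennreal_le_epsilon)
  then show "fine_cover_inf N Y \<alpha> \<epsilon> = 0" by simp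
qed

lemma flow_exit_time_nonneg: "0 \<le> flow_exit_time \<Phi> \<U> B"
  using flow_exit_time_ge_iff[of 0 \<Phi> \<U> B] by (auto simp: zero_ereal_def)

lemma map_exit_time_nonneg: "0 \<le> map_exit_time f \<U> B"
  using map_exit_time_ge_iff[of 0 f \<U> B] by (simp add: zero_ereal_def)

context topological_flow
begin

lemma flow_exit_time_le_map_exit_time:
  assumes t: "t > 0"
  shows "flow_exit_time \<Phi> \<U> B \<le> ereal t * map_exit_time (\<Phi> t) \<U> B"
  unfolding flow_exit_time_def
proof (rule Sup_least)
  fix z assume "z \<in> {ereal T |T. 0 \<le> T \<and> (\<forall>s. 0 \<le> s \<and> s < T \<longrightarrow> subordinate (\<Phi> s ` B) \<U>)}"
  then obtain T where T: "z = ereal T" "0 \<le> T"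
      "\<And>s. 0 \<le> s \<Longrightarrow> s < T \<Longrightarrow> subordinate (\<Phi> s ` B) \<U>"
    by auto
  define n where "n = nat \<lceil>T / t\<rceil>"
  have "subordinate ((\<Phi> t ^^ k) ` B) \<U>" if "k < n" for k
  proof -
    have "real k < T / t" using that t T(2) unfolding n_def by linarith
    then show ?thesis
      using t T(3)[of "real k * t"] by (simp add: flow_funpow field_simps)
  qed
  then have "ereal (real n) \<le> map_exit_time (\<Phi> t) \<U> B"
    by (simp add: map_exit_time_ge_iff)
  then have "ereal t * ereal (real n) \<le> ereal t * map_exit_time (\<Phi> t) \<U> B"
    using t by (intro ereal_mult_left_mono) auto
  moreover have "T \<le> t * real n"
    using t real_nat_ceiling_ge[of "T / t"] by (simp add: n_def field_simps)
  ultimately show "z \<le> ereal t * map_exit_time (\<Phi> t) \<U> B"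
    using T(1) by (simp add: order_trans[rotated])
qed

lemma map_topological_entropy_le_scaled:
  assumes t: "t > 0"
  shows "map_topological_entropy (\<Phi> t) Y \<le> ereal t * flow_topological_entropy \<Phi> Y"
  unfolding map_topological_entropy_def
proof (rule SUP_least)
  fix \<U> :: "'a set set" assume \<U>: "\<U> \<in> {\<U>. finite_open_cover \<U>}"
  have "exit_weight (map_exit_time (\<Phi> t) \<U>) B \<le> exit_weight (flow_exit_time \<Phi> \<U>) B powr (1 / t)" for B
  proof (cases "map_exit_time (\<Phi> t) \<U> B")
    case (real r)
    moreover obtain s where s: "flow_exit_time \<Phi> \<U> B = ereal s"
      using flow_exit_time_le_map_exit_time[OF t, of \<U> B] flow_exit_time_nonneg[of \<Phi> \<U> B] real
      by (cases "flow_exit_time \<Phi> \<U> B") auto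
    moreover have "s \<le> t * r"
      using flow_exit_time_le_map_exit_time[OF t, of \<U> B] real s by simp
    ultimately show ?thesis
      using t by (simp add: exit_weight_def powr_def field_simps)
  qed (use map_exit_time_nonneg[of "\<Phi> t" \<U> B] in \<open>auto simp: exit_weight_def\<close>)
  then have "cover_entropy (map_exit_time (\<Phi> t) \<U>) Y \<le> ereal t * cover_entropy (flow_exit_time \<Phi> \<U>) Y"
    by (rule cover_entropy_le_scaled[OF t])
  also have "\<dots> \<le> ereal t * flow_topological_entropy \<Phi> Y"
    unfolding flow_topological_entropy_def
    using t \<U> by (intro ereal_mult_left_mono SUP_upper) auto
  finally show "cover_entropy (map_exit_time (\<Phi> t) \<U>) Y \<le> ereal t * flow_topological_entropy \<Phi> Y" .
qed

end

section \<open>Generic points\<close>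

lemma integral_sum_translates:
  fixes f :: "real \<Rightarrow> real"
  assumes f: "continuous_on UNIV f" and m: "m \<ge> 0"
  shows "integral {a..a + m} (\<lambda>s. \<Sum>j<n. f (s + real j * m)) = integral {a..a + real n * m} f"
proof (induction n)
  case (Suc n)
  note cont = continuous_on_subset[OF f subset_UNIV]
  have int: "(\<lambda>s. f (s + c)) integrable_on {u..v}" for u v c
    by (intro integrable_continuous_real continuous_on_compose2[OF f] continuous_intros) auto
  have "integral {a..a + m} (\<lambda>s. \<Sum>j<Suc n. f (s + real j * m))
      = integral {a..a + m} (\<lambda>s. \<Sum>j<n. f (s + real j * m)) + integral {a..a + m} (\<lambda>s. f (s + real n * m))"
    by (simp add: integral_add integrable_sum int)
  also have "integral {a..a + m} (\<lambda>s. f (s + real n * m))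
      = integral {a + real n * m..a + real (Suc n) * m} f"
    using integral_shift[of a "real n * m" "a + m" f, OF cont]
    by (simp add: comp_def algebra_simps)
  also have "integral {a..a + m} (\<lambda>s. \<Sum>j<n. f (s + real j * m)) = integral {a..a + real n * m} f"
    by (rule Suc)
  also have "integral {a..a + real n * m} f + integral {a + real n * m..a + real (Suc n) * m} f
      = integral {a..a + real (Suc n) * m} f"
    using m int[of 0] by (intro Henstock_Kurzweil_Integration.integral_combine)
      (auto simp: algebra_simps)
  finally show ?case .
qed simp

context invariant_flow
begin

lemma integral_flow:
  fixes g :: "'a \<Rightarrow> real"
  assumes "continuous_on UNIV g"
  shows "(\<integral>y. g (\<Phi> s y) \<partial>M) = (\<integral>y. g y \<partial>M)"
proof -
  have "(\<integral>y. g y \<partial>M) = (\<integral>y. g y \<partial>distr M borel (\<Phi> s))"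
    by (simp add: invariant)
  also have "\<dots> = (\<integral>y. g (\<Phi> s y) \<partial>M)"
    by (intro integral_distr borel_measurable_M continuous_on_flow_map
        borel_measurable_continuous_onI assms)
  finally show ?thesis ..
qed

text \<open>
  The average over \<open>[0, n\<tau>]\<close> is an integral over offsets \<open>s \<in> [0, \<tau>]\<close> of Birkhoff averages
  of the continuous observable \<open>g \<circ> \<Phi> s\<close>. Invariance makes their limit independent of \<open>s\<close>.
\<close>

lemma flow_average_tendsto_along_multiples:
  fixes g :: "'a \<Rightarrow> real"
  assumes g: "continuous_on UNIV g" and bound: "\<And>y. \<bar>g y\<bar> \<le> C"
    and \<tau>: "\<tau> > 0" and x: "x \<in> map_generic_points M (\<Phi> \<tau>)"
  shows "(\<lambda>n. integral {0..real n * \<tau>} (\<lambda>t. g (\<Phi> t x)) / real n) \<longlonglongrightarrow> \<tau> * (\<integral>y. g y \<partial>M)"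
proof -
  have cont: "continuous_on UNIV (\<lambda>t. g (\<Phi> t x))"
    by (intro continuous_on_compose2[OF g] continuous_on_flow continuous_intros) auto
  have cont_shift: "continuous_on S (\<lambda>s. g (\<Phi> (s + c) x))" for S c
    by (intro continuous_on_compose2[OF g] continuous_on_flow continuous_intros) auto
  have lim: "(\<lambda>n. (\<Sum>j<n. g (\<Phi> (s + real j * \<tau>) x)) / real n) \<longlonglongrightarrow> (\<integral>y. g y \<partial>M)" for s
  proof -
    have "continuous_on UNIV (\<lambda>y. g (\<Phi> s y))"
      by (intro continuous_on_compose2[OF g] continuous_on_flow_map) auto
    then have "(\<lambda>n. (\<Sum>j<n. g (\<Phi> s ((\<Phi> \<tau> ^^ j) x))) / real n) \<longlonglongrightarrow> (\<integral>y. g (\<Phi> s y) \<partial>M)"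
      using x by (auto simp: map_generic_points_def)
    then show ?thesis
      by (simp add: flow_funpow flow_add integral_flow[OF g])
  qed
  have "(\<lambda>n. integral {0..\<tau>} (\<lambda>s. (\<Sum>j<n. g (\<Phi> (s + real j * \<tau>) x)) / real n))
      \<longlonglongrightarrow> integral {0..\<tau>} (\<lambda>s. \<integral>y. g y \<partial>M)"
  proof (rule dominated_convergence(2))
    show "(\<lambda>s. (\<Sum>j<n. g (\<Phi> (s + real j * \<tau>) x)) / real n) integrable_on {0..\<tau>}" for n
      unfolding divide_inverse
      by (intro integrable_continuous_real continuous_on_mult continuous_on_sum cont_shift continuous_on_const)
    show "(\<lambda>s. C) integrable_on {0..\<tau>}" by (rule integrable_const_ivl)
    fix n s
    have "\<bar>\<Sum>j<n. g (\<Phi> (s + real j * \<tau>) x)\<bar> \<le> (\<Sum>j<n. C)"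
      by (intro sum_abs[THEN order_trans] sum_mono bound)
    moreover have "0 \<le> C" using bound[of x] by linarith
    ultimately show "norm ((\<Sum>j<n. g (\<Phi> (s + real j * \<tau>) x)) / real n) \<le> C"
      by (cases "n = 0") (simp_all add: field_simps)
  qed (rule lim)
  moreover have "integral {0..\<tau>} (\<lambda>s. (\<Sum>j<n. g (\<Phi> (s + real j * \<tau>) x)) / real n)
      = integral {0..real n * \<tau>} (\<lambda>t. g (\<Phi> t x)) / real n" for n
    using integral_sum_translates[OF cont, of \<tau> 0 n] \<tau> by simp
  ultimately have "(\<lambda>n. integral {0..real n * \<tau>} (\<lambda>t. g (\<Phi> t x)) / real n)
      \<longlonglongrightarrow> integral {0..\<tau>} (\<lambda>s. \<integral>y. g y \<partial>M)"
    by (simp only:)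
  then show ?thesis using \<tau> by simp
qed

lemma map_generic_points_subset_flow_generic_points:
  assumes compact: "compact (UNIV :: 'a set)" and \<tau>: "\<tau> > 0"
  shows "map_generic_points M (\<Phi> \<tau>) \<subseteq> flow_generic_points M \<Phi>"
proof
  fix x assume x: "x \<in> map_generic_points M (\<Phi> \<tau>)"
  show "x \<in> flow_generic_points M \<Phi>"
    unfolding flow_generic_points_def
  proof (intro CollectI allI impI)
    fix g :: "'a \<Rightarrow> real" assume g: "continuous_on UNIV g"
    obtain C where C: "\<And>y. \<bar>g y\<bar> \<le> C"
      using compact_imp_bounded[OF compact_continuous_image[OF g compact]]
      by (auto simp: bounded_iff)
    let ?f = "\<lambda>t. g (\<Phi> t x)"
    have f: "continuous_on S ?f" for S
      by (intro continuous_on_compose2[OF g] continuous_on_flow continuous_intros) auto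
    define n where "n T = nat \<lfloor>T / \<tau>\<rfloor>" for T
    have "filterlim n at_top at_top"
      unfolding n_def using \<tau> by real_asymp
    then have "((\<lambda>T. integral {0..real (n T) * \<tau>} ?f / real (n T)) \<longlongrightarrow> \<tau> * (\<integral>y. g y \<partial>M)) at_top"
      by (rule filterlim_compose[OF flow_average_tendsto_along_multiples[OF g C \<tau> x]])
    moreover have "((\<lambda>T. real (n T) / T) \<longlongrightarrow> 1 / \<tau>) at_top"
      unfolding n_def using \<tau> by (real_asymp simp: inverse_eq_divide)
    ultimately have main: "((\<lambda>T. integral {0..real (n T) * \<tau>} ?f / real (n T) * (real (n T) / T))
        \<longlongrightarrow> \<tau> * (\<integral>y. g y \<partial>M) * (1 / \<tau>)) at_top"
      by (rule tendsto_mult)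
    have rest: "((\<lambda>T. integral {real (n T) * \<tau>..T} ?f / T) \<longlongrightarrow> 0) at_top"
    proof (rule Lim_null_comparison)
      show "((\<lambda>T. C * \<tau> / T) \<longlongrightarrow> 0) at_top" by real_asymp
      show "\<forall>\<^sub>F T in at_top. norm (integral {real (n T) * \<tau>..T} ?f / T) \<le> C * \<tau> / T"
        using eventually_gt_at_top[of 0]
      proof eventually_elim
        case (elim T)
        have n: "real (n T) \<le> T / \<tau>" "T / \<tau> < real (n T) + 1"
          using elim \<tau> unfolding n_def by (auto simp: of_nat_nat)
        have le: "real (n T) * \<tau> \<le> T" "T - real (n T) * \<tau> \<le> \<tau>"
          using n \<tau> by (auto simp: field_simps)
        have C0: "0 \<le> C" using C[of x] by linarith
        have "norm (integral {real (n T) * \<tau>..T} ?f) \<le> C * (T - real (n T) * \<tau>)"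
          using C by (intro integral_bound le f) auto
        also have "\<dots> \<le> C * \<tau>" using le C0 by (intro mult_left_mono)
        finally show ?case using elim by (simp add: divide_right_mono)
      qed
    qed
    have "\<forall>\<^sub>F T in at_top. integral {0..real (n T) * \<tau>} ?f / real (n T) * (real (n T) / T)
        + integral {real (n T) * \<tau>..T} ?f / T = integral {0..T} ?f / T"
      using eventually_ge_at_top[of \<tau>]
    proof eventually_elim
      case (elim T)
      then have "1 \<le> T / \<tau>" using \<tau> by simp
      then have pos: "n T \<noteq> 0" unfolding n_def by linarith
      have "real (n T) \<le> T / \<tau>"
        using elim \<tau> unfolding n_def by (auto simp: of_nat_nat)
      then have "real (n T) * \<tau> \<le> T" using \<tau> by (simp add: field_simps)
      then have "integral {0..real (n T) * \<tau>} ?f + integral {real (n T) * \<tau>..T} ?f = integral {0..T} ?f"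
        using \<tau> by (intro Henstock_Kurzweil_Integration.integral_combine integrable_continuous_real f) auto
      then show ?case using pos by (simp flip: add_divide_distrib)
    qed
    from tendsto_cong[OF this] tendsto_add[OF main rest]
    show "((\<lambda>T. integral {0..T} ?f / T) \<longlongrightarrow> (\<integral>y. g y \<partial>M)) at_top"
      using \<tau> by simp
  qed
qed

end

section \<open>Upper bound for the entropy of the generic points\<close>

text \<open>
  The products of weights of all words of length \<open>n\<close> sum to the \<open>n\<close>-th power of the total weight, and
  each word counted here contributes at least \<open>exp (- n c)\<close>.
\<close>

lemma card_low_cost_words_le:
  fixes w :: "'b \<Rightarrow> real" and n :: nat and c :: real
  assumes S: "finite S" and w: "\<And>e. e \<in> S \<Longrightarrow> 0 < w e"
  defines "W \<equiv> {\<omega> \<in> {..<n} \<rightarrow>\<^sub>E S. (\<Sum>j<n. - ln (w (\<omega> j))) \<le> real n * c}"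
  shows "real (card W) \<le> exp (real n * c) * (\<Sum>e\<in>S. w e) ^ n"
proof -
  have fin: "finite ({..<n} \<rightarrow>\<^sub>E S)" using S by (intro finite_PiE) auto
  have "real (card W) * exp (- (real n * c)) = (\<Sum>\<omega>\<in>W. exp (- (real n * c)))"
    by simp
  also have "\<dots> \<le> (\<Sum>\<omega>\<in>W. \<Prod>j<n. w (\<omega> j))"
  proof (rule sum_mono)
    fix \<omega> assume "\<omega> \<in> W"
    then have \<omega>: "\<And>j. j < n \<Longrightarrow> 0 < w (\<omega> j)" "- (real n * c) \<le> (\<Sum>j<n. ln (w (\<omega> j)))"
      using w by (auto simp: W_def PiE_iff sum_negf)
    have "exp (- (real n * c)) \<le> exp (\<Sum>j<n. ln (w (\<omega> j)))" using \<omega> by simp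
    also have "\<dots> = (\<Prod>j<n. w (\<omega> j))" using \<omega> by (simp add: exp_sum)
    finally show "exp (- (real n * c)) \<le> (\<Prod>j<n. w (\<omega> j))" .
  qed
  also have "\<dots> \<le> (\<Sum>\<omega>\<in>{..<n} \<rightarrow>\<^sub>E S. \<Prod>j<n. w (\<omega> j))"
  proof (rule sum_mono2[OF fin])
    fix \<omega> assume "\<omega> \<in> ({..<n} \<rightarrow>\<^sub>E S) - W"
    then have "0 < w (\<omega> j)" if "j < n" for j
      using that by (intro w) (auto simp: PiE_iff)
    then show "0 \<le> (\<Prod>j<n. w (\<omega> j))"
      by (intro prod_nonneg) (simp add: less_imp_le)
  qed (simp add: W_def)
  also have "\<dots> = (\<Prod>j<n. \<Sum>e\<in>S. w e)"
    using S by (intro prod_sum_PiE[symmetric]) auto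
  finally show ?thesis by (simp add: exp_minus field_simps)
qed

lemma exit_weight_le:
  assumes "ereal T \<le> N B"
  shows "exit_weight N B \<le> exp (- T)"
  using assms by (cases "N B") (auto simp: exit_weight_def)

context full_prob_space
begin

lemma integral_label:
  fixes g :: "'b \<Rightarrow> real"
  assumes X: "label X"
  shows "integrable M (\<lambda>x. g (X x))"
    and "(\<integral>x. g (X x) \<partial>M) = (\<Sum>v\<in>range X. prob (X -` {v}) * g v)"
proof -
  have eq: "g (X x) = (\<Sum>v\<in>range X. g v * indicator (X -` {v}) x)" for x
    using label_finite[OF X] by (simp add: indicator_def sum.If_cases if_distrib sum.delta cong: if_cong)
  have int: "integrable M (\<lambda>x. g v * indicator (X -` {v}) x :: real)" for v
    using label_sets[OF X, of v]
    by (intro integrable_mult_right integrable_real_indicator) (auto simp: emeasure_eq_measure)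
  show "integrable M (\<lambda>x. g (X x))"
    unfolding eq by (intro Bochner_Integration.integrable_sum int)
  show "(\<integral>x. g (X x) \<partial>M) = (\<Sum>v\<in>range X. prob (X -` {v}) * g v)"
    unfolding eq using label_sets[OF X] int
    by (subst Bochner_Integration.integral_sum) (auto simp: mult.commute)
qed

text \<open>
  Adding \<open>\<kappa>\<close> to the probabilities keeps the cost finite on values of probability \<open>0\<close>, which an
  orbit may well visit, and only lowers the mean cost.
\<close>

lemma cross_entropy_le:
  assumes X: "label X" and \<kappa>: "\<kappa> > 0"
  shows "(\<integral>x. - ln (prob (X -` {X x}) + \<kappa>) \<partial>M) \<le> H X"
proof -
  have "(\<integral>x. - ln (prob (X -` {X x}) + \<kappa>) \<partial>M)
      = (\<Sum>v\<in>range X. prob (X -` {v}) * - ln (prob (X -` {v}) + \<kappa>))"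
    by (rule integral_label(2)[OF X, of "\<lambda>v. - ln (prob (X -` {v}) + \<kappa>)"])
  also have "\<dots> \<le> (\<Sum>v\<in>range X. prob (X -` {v}) * - ln (prob (X -` {v})))"
  proof (rule sum_mono)
    fix v
    show "prob (X -` {v}) * - ln (prob (X -` {v}) + \<kappa>) \<le> prob (X -` {v}) * - ln (prob (X -` {v}))"
    proof (cases "prob (X -` {v}) = 0")
      case False
      then have "0 < prob (X -` {v})" by (simp add: zero_less_measure_iff)
      then show ?thesis using \<kappa> by (intro mult_left_mono) auto
    qed simp
  qed
  also have "\<dots> = H X"
    using label_finite[OF X] by (simp add: H_eq_sum[of "range X" X] sum_negf)
  finally show ?thesis .
qed

lemma sum_prob_label:
  assumes X: "label X"
  shows "(\<Sum>v\<in>range X. prob (X -` {v})) = 1"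
  using integral_label(2)[OF X, of "\<lambda>_. 1"] prob_space by simp

end

text \<open>
  Points off the spheres are interior to their piece of the partition that records which balls contain a point.
\<close>

lemma eventually_balls_eq:
  fixes x :: "'b::metric_space"
  assumes C: "finite C" and x: "\<forall>c\<in>C. dist c x \<noteq> r"
  shows "\<forall>\<^sub>F y in nhds x. {c\<in>C. dist c y < r} = {c\<in>C. dist c x < r}"
proof -
  have "\<forall>\<^sub>F y in nhds x. (dist c y < r) = (dist c x < r)" if "c \<in> C" for c
  proof -
    have lim: "((\<lambda>y. dist c y) \<longlongrightarrow> dist c x) (nhds x)"
      by (intro tendsto_intros) (simp add: filterlim_ident)
    show ?thesis
    proof (cases "dist c x < r")
      case True
      with order_tendstoD(2)[OF lim True] show ?thesis by simp
    next
      case False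
      with x that have "r < dist c x" by (metis linorder_neqE_linordered_idom)
      from order_tendstoD(1)[OF lim this] show ?thesis
        by eventually_elim (use False in auto)
    qed
  qed
  with C have "\<forall>\<^sub>F y in nhds x. \<forall>c\<in>C. (dist c y < r) = (dist c x < r)"
    by (simp add: eventually_ball_finite)
  then show ?thesis by eventually_elim blast
qed

context invariant_flow
begin

lemma label_balls:
  assumes "finite C"
  shows "label (\<lambda>x. {c\<in>C. dist c x < r})"
proof -
  have "range (\<lambda>x. {c\<in>C. dist c x < r}) \<subseteq> Pow C" by auto
  then have fin: "finite (range (\<lambda>x. {c\<in>C. dist c x < r}))"
    using assms by (meson finite_Pow_iff finite_subset)
  have ball: "{x. dist c x < r} \<in> sets M" for c
    using open_ball[of c r] by (simp add: sets_eq_borel ball_def)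
  have side: "{x. (dist c x < r) = (c \<in> A)} \<in> sets M" for c A
  proof (cases "c \<in> A")
    case False
    then have "{x. (dist c x < r) = (c \<in> A)} = space M - {x. dist c x < r}"
      by (auto simp: space_eq_UNIV)
    then show ?thesis using sets.compl_sets[OF ball[of c]] by (simp only:)
  qed (use ball[of c] in simp)
  have "(\<lambda>x. {c\<in>C. dist c x < r}) -` {A} \<in> sets M" for A
  proof (cases "A \<subseteq> C")
    case True
    then have "(\<lambda>x. {c\<in>C. dist c x < r}) -` {A} = {x. \<forall>c\<in>C. (dist c x < r) = (c \<in> A)}"
      unfolding vimage_def singleton_iff set_eq_iff mem_Collect_eq by blast
    then show ?thesis
      using sets.sets_Collect_finite_All[of C M "\<lambda>c x. (dist c x < r) = (c \<in> A)"] side assms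
      by (simp add: space_eq_UNIV)
  next
    case False
    then have "(\<lambda>x. {c\<in>C. dist c x < r}) -` {A} = {}" by blast
    then show ?thesis by simp
  qed
  with fin show ?thesis by (simp add: label_def)
qed

text \<open>
  The distribution of the distance to a point has at most countably many atoms.
\<close>

lemma ex_radius_null_spheres:
  fixes C :: "'a set"
  assumes "finite C" "a < b"
  shows "\<exists>r. a < r \<and> r < b \<and> (\<forall>c\<in>C. prob {x. dist c x = r} = 0)"
proof -
  define Bad where "Bad c = {r. measure (distr M borel (dist c)) {r} \<noteq> 0}" for c
  have dist_meas: "dist c \<in> borel_measurable M" for c
    by (intro borel_measurable_M continuous_intros)
  have eq: "measure (distr M borel (dist c)) {r} = prob {x. dist c x = r}" for c r
    using dist_meas by (subst measure_distr) (auto simp: vimage_def space_eq_UNIV)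
  have "countable (Bad c)" for c
  proof -
    interpret D: prob_space "distr M borel (dist c)"
      by (rule prob_space_distr[OF dist_meas])
    show ?thesis unfolding Bad_def by (rule D.countable_support)
  qed
  then have "countable (\<Union>c\<in>C. Bad c)"
    using countable_UN[OF countable_finite[OF assms(1)], of Bad] by blast
  then have "\<not> {a<..<b} \<subseteq> (\<Union>c\<in>C. Bad c)"
    using uncountable_open_interval[of a b] assms(2) countable_subset by blast
  then show ?thesis by (auto simp: Bad_def eq)
qed

text \<open>
  The majorants are the Lipschitz envelopes \<open>V k x = (SUP y. v y - k * dist x y)\<close>. They are
  continuous and decrease to \<open>v\<close> at every point of continuity of \<open>v\<close>, so their integrals converge to that of
  \<open>v\<close>. This makes the convergence of averages of continuous functions available for a cost that is
  discontinuous on a null set.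
\<close>

lemma ex_continuous_majorant:
  fixes v :: "'a \<Rightarrow> real"
  assumes bound: "\<And>x. \<bar>v x\<bar> \<le> B" and v: "integrable M v"
    and cont: "AE x in M. isCont v x" and e: "e > 0"
  shows "\<exists>V. continuous_on UNIV V \<and> (\<forall>x. v x \<le> V x) \<and> (\<integral>x. V x \<partial>M) < (\<integral>x. v x \<partial>M) + e"
proof -
  define V where "V k x = (SUP y. v y - real k * dist x y)" for k x
  have le_B: "v y - real k * dist x y \<le> B" for k x y
  proof -
    have "0 \<le> real k * dist x y" by simp
    then show ?thesis using bound[of y] by linarith
  qed
  have bdd: "bdd_above (range (\<lambda>y. v y - real k * dist x y))" for k x
    using le_B by (auto intro!: bdd_aboveI)
  have ge: "v y - real k * dist x y \<le> V k x" for k x y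
    unfolding V_def using bdd by (rule cSUP_upper[rotated]) simp
  have ge_v: "v x \<le> V k x" for k x
    using ge[of x k x] by simp
  have V_B: "V k x \<le> B" for k x
    unfolding V_def by (rule cSUP_least) (auto simp: le_B)
  have lip: "V k x \<le> V k x' + real k * dist x x'" for k x x'
    unfolding V_def[of k x]
  proof (rule cSUP_least)
    fix y
    have "real k * dist x' y \<le> real k * (dist x x' + dist x y)"
      by (intro mult_left_mono) (metis dist_commute dist_triangle, simp)
    then show "v y - real k * dist x y \<le> V k x' + real k * dist x x'"
      using ge[of y k x'] by (simp add: algebra_simps)
  qed simp
  have "(real k)-lipschitz_on UNIV (V k)" for k
  proof (rule lipschitz_onI)
    fix x y
    show "dist (V k x) (V k y) \<le> real k * dist x y"
      using lip[of k x y] lip[of k y x] by (simp add: dist_real_def dist_commute)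
  qed simp
  then have contV: "continuous_on UNIV (V k)" for k
    by (rule lipschitz_on_continuous_on)
  have lim: "(\<lambda>k. V k x) \<longlonglongrightarrow> v x" if "isCont v x" for x
  proof (rule order_tendstoI)
    fix l assume "l < v x"
    then show "\<forall>\<^sub>F k in sequentially. l < V k x"
      using ge_v[of x] by (intro always_eventually allI) (rule less_le_trans)
  next
    fix u assume u: "v x < u"
    define u' where "u' = (v x + u) / 2"
    have u': "v x < u'" "u' < u" using u by (auto simp: u'_def)
    from that have "(v \<longlongrightarrow> v x) (nhds x)"
      by (simp add: continuous_at tendsto_at_iff_tendsto_nhds)
    then have "\<forall>\<^sub>F y in nhds x. v y < u'"
      by (rule order_tendstoD(2)[OF _ u'(1)])
    then obtain \<delta> where \<delta>: "\<delta> > 0" "\<And>y. dist y x < \<delta> \<Longrightarrow> v y < u'"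
      by (auto simp: eventually_nhds_metric)
    obtain k0 :: nat where k0: "(B - u') / \<delta> \<le> real k0"
      using real_arch_simple by blast
    have "V k x < u" if k: "k \<ge> k0" for k
    proof -
      have "V k x \<le> u'"
        unfolding V_def
      proof (rule cSUP_least)
        fix y
        show "v y - real k * dist x y \<le> u'"
        proof (cases "dist y x < \<delta>")
          case True
          have "0 \<le> real k * dist x y" by simp
          then show ?thesis using \<delta>(2)[OF True] by linarith
        next
          case False
          have "B - u' \<le> real k0 * \<delta>" using k0 \<delta>(1) by (simp add: field_simps)
          also have "\<dots> \<le> real k * dist x y"
            using k False \<delta>(1) by (intro mult_mono) (auto simp: dist_commute)
          finally show ?thesis using bound[of y] by linarith
        qed
      qed simp
      with u' show ?thesis by simp
    qed
    then show "\<forall>\<^sub>F k in sequentially. V k x < u"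
      by (auto simp: eventually_sequentially)
  qed
  have "(\<lambda>k. \<integral>x. V k x \<partial>M) \<longlonglongrightarrow> (\<integral>x. v x \<partial>M)"
  proof (rule integral_dominated_convergence[where w = "\<lambda>_. B"])
    show "AE x in M. (\<lambda>k. V k x) \<longlonglongrightarrow> v x" using cont lim by auto
    show "AE x in M. norm (V k x) \<le> B" for k
    proof (rule AE_I2)
      fix x show "norm (V k x) \<le> B"
        using V_B[of k x] ge_v[of x k] bound[of x] by simp
    qed
  qed (use v contV borel_measurable_M in auto)
  then have "\<forall>\<^sub>F k in sequentially. (\<integral>x. V k x \<partial>M) < (\<integral>x. v x \<partial>M) + e"
    using e by (intro order_tendstoD) auto
  then obtain k where "(\<integral>x. V k x \<partial>M) < (\<integral>x. v x \<partial>M) + e"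
    by (auto simp: eventually_sequentially)
  then show ?thesis using contV[of k] ge_v[of _ k] by blast
qed

text \<open>
  The average of \<open>V\<close> over the orbit segment from \<open>- m\<close> to \<open>(n - 1) m\<close> is the mean over
  the offsets \<open>s\<close> of the averages along \<open>s + j m\<close>, so some offset does not exceed it. Offsets are
  taken in \<open>[- m, 0]\<close> so that the sampled segment begins no later than time \<open>0\<close>.
\<close>

lemma ex_offset_average_le:
  fixes V :: "'a \<Rightarrow> real"
  assumes V: "continuous_on UNIV V" and x: "x \<in> flow_generic_points M \<Phi>"
    and b: "(\<integral>y. V y \<partial>M) < b" and m: "m > 0"
  shows "\<forall>\<^sub>F n in sequentially. \<exists>s. - m \<le> s \<and> s \<le> 0 \<and>
    (\<Sum>j<n. V (\<Phi> (s + real j * m) x)) \<le> real n * b"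
proof -
  let ?f = "\<lambda>t. V (\<Phi> t x)"
  have f: "continuous_on S ?f" for S
    by (intro continuous_on_compose2[OF V] continuous_on_flow continuous_intros) auto
  have f_shift: "continuous_on S (\<lambda>s. V (\<Phi> (s + c) x))" for S c
    by (intro continuous_on_compose2[OF V] continuous_on_flow continuous_intros) auto
  have "((\<lambda>T. integral {0..T} ?f / T) \<longlongrightarrow> (\<integral>y. V y \<partial>M)) at_top"
    using x V by (simp add: flow_generic_points_def)
  moreover have "filterlim (\<lambda>n. (real n - 1) * m) at_top sequentially"
    using m by real_asymp
  ultimately have "(\<lambda>n. integral {0..(real n - 1) * m} ?f / ((real n - 1) * m)) \<longlonglongrightarrow> (\<integral>y. V y \<partial>M)"
    by (rule filterlim_compose)
  moreover have "(\<lambda>n. (real n - 1) / real n) \<longlonglongrightarrow> 1" by real_asymp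
  ultimately have "(\<lambda>n. integral {0..(real n - 1) * m} ?f / ((real n - 1) * m) * ((real n - 1) / real n))
      \<longlonglongrightarrow> (\<integral>y. V y \<partial>M) * 1"
    by (rule tendsto_mult)
  moreover have "(\<lambda>n. integral {- m..0} ?f / (real n * m)) \<longlonglongrightarrow> 0"
    using lim_const_over_n[of "integral {- m..0} ?f / m"] by (simp add: mult.commute)
  ultimately have "(\<lambda>n. integral {0..(real n - 1) * m} ?f / ((real n - 1) * m) * ((real n - 1) / real n)
      + integral {- m..0} ?f / (real n * m)) \<longlonglongrightarrow> (\<integral>y. V y \<partial>M) * 1 + 0"
    by (rule tendsto_add)
  then have "\<forall>\<^sub>F n in sequentially. integral {0..(real n - 1) * m} ?f / ((real n - 1) * m)
      * ((real n - 1) / real n) + integral {- m..0} ?f / (real n * m) < b"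
    using b by (intro order_tendstoD) auto
  then show ?thesis
    using eventually_gt_at_top[of 1]
  proof eventually_elim
    case (elim n)
    have n: "1 < real n" using elim by simp
    have "integral {0..(real n - 1) * m} ?f / ((real n - 1) * m) * ((real n - 1) / real n)
        = integral {0..(real n - 1) * m} ?f / (real n * m)"
      using n by simp
    with elim have "(integral {- m..0} ?f + integral {0..(real n - 1) * m} ?f) / (real n * m) < b"
      by (simp add: add_divide_distrib add.commute mult.commute)
    also have "integral {- m..0} ?f + integral {0..(real n - 1) * m} ?f = integral {- m..(real n - 1) * m} ?f"
      using m n by (intro Henstock_Kurzweil_Integration.integral_combine integrable_continuous_real f) auto
    also have "\<dots> = integral {- m..0} (\<lambda>s. \<Sum>j<n. ?f (s + real j * m))"
      using integral_sum_translates[OF f, of m "- m" n] m by (simp add: algebra_simps)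
    finally have less: "integral {- m..0} (\<lambda>s. \<Sum>j<n. ?f (s + real j * m)) < real n * b * m"
      using m n by (simp add: field_simps)
    show ?case
    proof (rule ccontr)
      assume "\<not> ?case"
      then have gt: "real n * b \<le> (\<Sum>j<n. ?f (s + real j * m))" if "s \<in> {- m..0}" for s
        using that by (meson atLeastAtMost_iff linear)
      have "integral {- m..0} (\<lambda>s. real n * b) \<le> integral {- m..0} (\<lambda>s. \<Sum>j<n. ?f (s + real j * m))"
        by (rule integral_le)
          (auto intro!: integrable_continuous_real continuous_on_sum f_shift gt simp: continuous_on_const)
      then show False using less m by (simp add: mult_ac)
    qed
  qed
qed

text \<open>
  The counting argument behind Bowen's bound. A covering set consists of the points that realise a given
  cheap word of length \<open>n\<close> at an offset in a given interval of length \<open>\<eta>\<close>. Up to a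
  constant factor there are at most \<open>exp (n (H q + 3 e))\<close> such sets, with \<open>e\<close> as small as desired, and their
  exit times are at least \<open>(n - 1) m\<close>. As \<open>H q < \<alpha> * m\<close>, the
  sums of their weights form a convergent geometric series in \<open>n\<close>. The hypothesis on \<open>\<rho>\<close> says that
  equal values of \<open>q\<close>, even at slightly different times, force two orbits to stay close for time \<open>m\<close>.
\<close>

lemma entropy_outer_measure_generic_points_eq_0:
  fixes q :: "'a \<Rightarrow> 'b"
  assumes q: "label q" and H: "H q < \<alpha> * m" and m: "m > 0" and \<eta>: "\<eta> > 0"
    and locally_const: "AE x in M. \<forall>\<^sub>F y in nhds x. q y = q x"
    and lebesgue: "\<And>x. \<exists>U\<in>\<U>. ball x \<rho> \<subseteq> U"
    and close: "\<And>a b r r' t. \<lbrakk>q (\<Phi> r a) = q (\<Phi> r' b); 0 \<le> r; r \<le> \<eta>; 0 \<le> r'; r' \<le> \<eta>; 0 \<le> t; t \<le> m\<rbrakk>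
      \<Longrightarrow> dist (\<Phi> t a) (\<Phi> t b) < \<rho>"
  shows "entropy_outer_measure (flow_exit_time \<Phi> \<U>) (flow_generic_points M \<Phi>) \<alpha> = 0"
proof -
  define e where "e = (\<alpha> * m - H q) / 4"
  have e: "e > 0" "H q + 3 * e - \<alpha> * m = - e" using H by (auto simp: e_def field_simps)
  define S where "S = range q"
  have S: "finite S" "card S > 0" using label_finite[OF q] by (auto simp: S_def card_gt_0_iff)
  \<comment> \<open>The summand keeps the weights positive; it is so small that their sum is at most \<open>exp e\<close>.\<close>
  define w where "w u = prob (q -` {u}) + e / real (card S)" for u
  have \<kappa>: "0 < e / real (card S)" using e S by simp
  have w_pos: "0 < w u" for u unfolding w_def using \<kappa> by (simp add: add_nonneg_pos)
  have w_sum: "(\<Sum>u\<in>S. w u) \<le> exp e"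
    using sum_prob_label[OF q] S exp_ge_add_one_self[of e] by (simp add: w_def sum.distrib S_def)
  define v where "v x = - ln (w (q x))" for x
  have v_int: "integrable M v" "(\<integral>x. v x \<partial>M) \<le> H q"
    unfolding v_def w_def
    using integral_label(1)[OF q, of "\<lambda>u. - ln (prob (q -` {u}) + e / real (card S))"]
      cross_entropy_le[OF q \<kappa>] by auto
  have "\<bar>v x\<bar> \<le> (\<Sum>u\<in>S. \<bar>ln (w u)\<bar>)" for x
    unfolding v_def abs_minus by (rule member_le_sum) (use S in \<open>auto simp: S_def\<close>)
  moreover have "AE x in M. isCont v x"
    using locally_const
  proof eventually_elim
    case (elim x)
    then have "\<forall>\<^sub>F y in nhds x. v y = v x" by eventually_elim (simp add: v_def)
    then have "(v \<longlongrightarrow> v x) (nhds x)" by (rule tendsto_eventually)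
    then show ?case by (simp add: continuous_at tendsto_at_iff_tendsto_nhds)
  qed
  ultimately obtain V where V: "continuous_on UNIV V" "\<And>x. v x \<le> V x"
      "(\<integral>x. V x \<partial>M) < (\<integral>x. v x \<partial>M) + e"
    using ex_continuous_majorant[of v _ e] v_int(1) e(1) by blast
  define b where "b = H q + 2 * e"
  have b: "(\<integral>x. V x \<partial>M) < b" using V(3) v_int(2) e(1) by (simp add: b_def)

  define W where "W n = {\<omega> \<in> {..<n} \<rightarrow>\<^sub>E S. (\<Sum>j<n. - ln (w (\<omega> j))) \<le> real n * b}" for n :: nat
  have W_fin: "finite (W n)" for n
    unfolding W_def using S by (intro finite_subset[OF _ finite_PiE[of "{..<n}" "\<lambda>_. S"]]) auto
  have W_card: "real (card (W n)) \<le> exp (real n * (b + e))" for n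
  proof -
    have "real (card (W n)) \<le> exp (real n * b) * (\<Sum>u\<in>S. w u) ^ n"
      unfolding W_def by (rule card_low_cost_words_le[OF S(1) w_pos])
    also have "\<dots> \<le> exp (real n * b) * exp e ^ n"
      using w_pos w_sum by (intro mult_left_mono power_mono) (auto intro!: sum_nonneg simp: less_imp_le)
    also have "\<dots> = exp (real n * (b + e))"
      by (simp add: exp_of_nat_mult[symmetric] exp_add[symmetric] algebra_simps)
    finally show ?thesis .
  qed

  \<comment> \<open>The number \<open>i\<close> selects the interval \<open>[i \<eta> - m, (i + 1) \<eta> - m]\<close> of offsets; those with
    \<open>i \<le> I\<close> exhaust \<open>[- m, 0]\<close>.\<close>
  define cell where "cell n i \<omega> = {x. \<exists>r. 0 \<le> r \<and> r \<le> \<eta> \<and>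
    (\<forall>j<n. q (\<Phi> (r + (real i * \<eta> - m + real j * m)) x) = \<omega> j)}"
    for n i and \<omega> :: "nat \<Rightarrow> 'b"
  define I where "I = nat \<lfloor>m / \<eta>\<rfloor>"
  have I: "real i * \<eta> \<le> m" if "i \<le> I" for i
  proof -
    have "real i \<le> m / \<eta>" using that m \<eta> unfolding I_def by (simp add: le_nat_iff le_floor_iff)
    then show ?thesis using \<eta> by (simp add: field_simps)
  qed
  define F where "F n = (\<lambda>(i, \<omega>). cell n i \<omega>) ` ({..I} \<times> W n)" for n
  have F_card: "real (card (F n)) \<le> real (I + 1) * exp (real n * (b + e))" for n
  proof -
    have "card (F n) \<le> card ({..I} \<times> W n)"
      unfolding F_def by (rule card_image_le) (simp add: W_fin)
    then have "real (card (F n)) \<le> real ((I + 1) * card (W n))"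
      by (subst of_nat_le_iff) (simp add: card_cartesian_product)
    also have "\<dots> = real (I + 1) * real (card (W n))"
      by (rule of_nat_mult)
    also have "\<dots> \<le> real (I + 1) * exp (real n * (b + e))"
      by (intro mult_left_mono W_card) simp
    finally show ?thesis .
  qed

  have cover_nonempty: "\<exists>U. U \<in> \<U>" using lebesgue by blast
  have cell_exit: "ereal (real n * m - m) \<le> flow_exit_time \<Phi> \<U> (cell n i \<omega>)" if i: "i \<le> I" for n i \<omega>
  proof (cases "n = 0")
    case True
    then show ?thesis
      using m flow_exit_time_nonneg[of \<Phi> \<U>] order_trans[of "ereal (- m)" 0] by simp
  next
    case False
    then have "0 \<le> real n * m - m"
      using m mult_right_mono[of 1 "real n" m] by simp
    then show ?thesis
    proof (subst flow_exit_time_ge_iff, assumption, intro allI impI)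
      fix T assume T: "0 \<le> T \<and> T < real n * m - m"
      \<comment> \<open>Time measured from the left end of the interval of offsets; the \<open>j\<close>-th letter governs
        the part of it between \<open>j m\<close> and \<open>(j + 1) m\<close>.\<close>
      define T' where "T' = T + m - real i * \<eta>"
      have "0 \<le> real i * \<eta>" using \<eta> by simp
      then have T': "0 \<le> T'" "T' < real n * m"
        using T I[OF i] unfolding T'_def by linarith+
      define j where "j = nat \<lfloor>T' / m\<rfloor>"
      define t where "t = T' - real j * m"
      have "real j = of_int \<lfloor>T' / m\<rfloor>" using T' m by (simp add: j_def)
      then have "real j \<le> T' / m" "T' / m < real j + 1" by linarith+
      then have j: "0 \<le> t" "t \<le> m" "real j * m \<le> T'"
        using m by (auto simp: t_def field_simps)
      have "real j * m < real n * m" using j(3) T'(2) by linarith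
      then have jn: "j < n" using m by simp
      have near: "dist (\<Phi> T x) (\<Phi> T y) < \<rho>" if xy: "x \<in> cell n i \<omega>" "y \<in> cell n i \<omega>" for x y
      proof -
        let ?s = "real i * \<eta> - m + real j * m"
        obtain r r' where r: "0 \<le> r" "r \<le> \<eta>" "0 \<le> r'" "r' \<le> \<eta>"
            "q (\<Phi> (r + ?s) x) = \<omega> j" "q (\<Phi> (r' + ?s) y) = \<omega> j"
          using xy jn unfolding cell_def by blast
        then have "q (\<Phi> r (\<Phi> ?s x)) = q (\<Phi> r' (\<Phi> ?s y))"
          by (simp add: flow_add)
        from close[OF this r(1-4) j(1,2)] have "dist (\<Phi> (t + ?s) x) (\<Phi> (t + ?s) y) < \<rho>"
          by (simp add: flow_add)
        moreover have "t + ?s = T" by (simp add: t_def T'_def)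
        ultimately show ?thesis by simp
      qed
      show "subordinate (\<Phi> T ` cell n i \<omega>) \<U>"
      proof (cases "cell n i \<omega> = {}")
        case True
        then show ?thesis using cover_nonempty by (auto simp: subordinate_def)
      next
        case False
        then obtain x where x: "x \<in> cell n i \<omega>" by blast
        obtain U where "U \<in> \<U>" "ball (\<Phi> T x) \<rho> \<subseteq> U" using lebesgue by blast
        moreover have "\<Phi> T ` cell n i \<omega> \<subseteq> ball (\<Phi> T x) \<rho>"
          using near[OF x] by (intro image_subsetI) simp
        ultimately show ?thesis
          unfolding subordinate_def by blast
      qed
    qed
  qed
  show ?thesis
  proof (rule entropy_outer_measure_eq_0I[where F = F and d = "\<lambda>n. exp (m - real n * m)"])
    show "finite (F n)" for n by (simp add: F_def W_fin)
    show "exit_weight (flow_exit_time \<Phi> \<U>) B \<le> exp (m - real n * m)" if "B \<in> F n" for n B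
    proof -
      from that obtain i \<omega> where "i \<le> I" "B = cell n i \<omega>" by (auto simp: F_def)
      then show ?thesis
        using exit_weight_le[of "real n * m - m" "flow_exit_time \<Phi> \<U>" B] cell_exit by simp
    qed
    show "(\<lambda>n. exp (m - real n * m)) \<longlonglongrightarrow> 0" using m by real_asymp
    show "summable (\<lambda>n. real (card (F n)) * exp (m - real n * m) powr \<alpha>)"
    proof (rule summable_comparison_test')
      show "summable (\<lambda>n. real (I + 1) * exp (\<alpha> * m) * exp (- e) ^ n)"
        using e(1) by (intro summable_mult summable_geometric) simp
      fix n :: nat
      have "real (card (F n)) * exp (m - real n * m) powr \<alpha>
          \<le> real (I + 1) * exp (real n * (b + e)) * exp (m - real n * m) powr \<alpha>"
        by (intro mult_right_mono F_card) simp
      also have "\<dots> = real (I + 1) * (exp (real n * (b + e)) * exp (\<alpha> * (m - real n * m)))"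
        by (simp add: powr_def mult.assoc)
      also have "\<dots> = real (I + 1) * (exp (\<alpha> * m) * exp (real n * (H q + 3 * e - \<alpha> * m)))"
        unfolding exp_add[symmetric] by (simp add: b_def algebra_simps)
      also have "\<dots> = real (I + 1) * exp (\<alpha> * m) * exp (- e) ^ n"
        by (simp add: e(2) exp_of_nat_mult[symmetric])
      finally show "norm (real (card (F n)) * exp (m - real n * m) powr \<alpha>)
          \<le> real (I + 1) * exp (\<alpha> * m) * exp (- e) ^ n" by simp
    qed
    show "exit_weight (flow_exit_time \<Phi> \<U>) {} = 0"
    proof -
      have "flow_exit_time \<Phi> \<U> {} = \<infinity>"
        using cover_nonempty by (auto simp: flow_exit_time_eq_top_iff subordinate_def)
      then show ?thesis by (simp add: exit_weight_def)
    qed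
    have "0 < \<alpha> * m" using H H_nonneg[of q] by linarith
    then show "\<alpha> > 0" using m by (simp add: zero_less_mult_iff)
    show "flow_generic_points M \<Phi> \<subseteq> (\<Union>n\<in>{k..}. \<Union>(F n))" for k
    proof
      fix x assume x: "x \<in> flow_generic_points M \<Phi>"
      have "\<forall>\<^sub>F n in sequentially. k \<le> n \<and> (\<exists>s. - m \<le> s \<and> s \<le> 0 \<and>
          (\<Sum>j<n. V (\<Phi> (s + real j * m) x)) \<le> real n * b)"
        by (intro eventually_conj eventually_ge_at_top ex_offset_average_le[OF V(1) x b m])
      from eventually_happens'[OF sequentially_bot this]
      obtain n s where n: "k \<le> n" and s: "- m \<le> s" "s \<le> 0"
          "(\<Sum>j<n. V (\<Phi> (s + real j * m) x)) \<le> real n * b"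
        by blast
      define \<omega> where "\<omega> = (\<lambda>j\<in>{..<n}. q (\<Phi> (s + real j * m) x))"
      have "(\<Sum>j<n. - ln (w (\<omega> j))) \<le> (\<Sum>j<n. V (\<Phi> (s + real j * m) x))"
        using V(2) by (intro sum_mono) (simp add: \<omega>_def v_def)
      then have \<omega>: "\<omega> \<in> W n" using s(3) by (auto simp: W_def \<omega>_def S_def)
      define i where "i = nat \<lfloor>(s + m) / \<eta>\<rfloor>"
      have "real i = of_int \<lfloor>(s + m) / \<eta>\<rfloor>" using s(1) \<eta> by (simp add: i_def)
      then have "real i \<le> (s + m) / \<eta>" "(s + m) / \<eta> < real i + 1" by linarith+
      then have r: "0 \<le> s + m - real i * \<eta>" "s + m - real i * \<eta> \<le> \<eta>"
        using \<eta> by (auto simp: field_simps)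
      have "x \<in> cell n i \<omega>"
        unfolding cell_def
        by (intro CollectI exI[of _ "s + m - real i * \<eta>"] conjI r allI impI)
          (simp add: \<omega>_def algebra_simps)
      moreover have "i \<le> I"
        unfolding i_def I_def using s(2) \<eta> by (intro nat_mono floor_mono divide_right_mono) auto
      ultimately show "x \<in> (\<Union>n\<in>{k..}. \<Union>(F n))"
        using n \<omega> unfolding F_def by blast
    qed
  qed
qed

text \<open>
  For a given cover, \<open>entropy_outer_measure_generic_points_eq_0\<close> is applied to the itinerary \<open>q\<close> of a partition into
  pieces so small that equal pieces at the integer times keep the orbits within a Lebesgue number of the cover at
  all times in between.
\<close>

lemma cover_entropy_generic_points_le:
  assumes compact: "compact (UNIV :: 'a set)" and \<U>: "finite_open_cover \<U>"
  shows "cover_entropy (flow_exit_time \<Phi> \<U>) (flow_generic_points M \<Phi>) \<le> metric_entropy M (\<Phi> 1)"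
proof (rule ccontr)
  assume "\<not> ?thesis"
  then obtain \<alpha> where \<alpha>: "metric_entropy M (\<Phi> 1) < ereal \<alpha>"
      "ereal \<alpha> < cover_entropy (flow_exit_time \<Phi> \<U>) (flow_generic_points M \<Phi>)"
    using ereal_dense2 by (metis not_le)
  obtain \<rho> where \<rho>: "\<rho> > 0" "\<And>x. \<exists>U\<in>\<U>. ball x \<rho> \<subseteq> U"
    using Heine_Borel_lemma[OF compact, of \<U>] \<U> by (auto simp: finite_open_cover_def)
  have "uniformly_continuous_on ({-1..1} \<times> UNIV) (\<lambda>z. \<Phi> (fst z) (snd z))"
    by (intro compact_uniformly_continuous continuous_on_flow continuous_intros compact_Times compact) auto
  then obtain \<kappa> where \<kappa>: "\<kappa> > 0"
    "\<And>s s' x y. \<lbrakk>\<bar>s\<bar> \<le> 1; \<bar>s'\<bar> \<le> 1; dist (s, x) (s', y) < \<kappa>\<rbrakk> \<Longrightarrow> dist (\<Phi> s x) (\<Phi> s' y) < \<rho>"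
    using \<rho>(1) unfolding uniformly_continuous_on_def
    by (force simp: dist_commute abs_le_iff)
  have near: "dist (\<Phi> s x) (\<Phi> s' y) < \<rho>"
    if "\<bar>s\<bar> \<le> 1" "\<bar>s'\<bar> \<le> 1" "\<bar>s - s'\<bar> \<le> \<kappa> / 2" "dist x y < \<kappa> / 2" for s s' x y
  proof -
    have "dist (s, x) (s', y) \<le> \<bar>s - s'\<bar> + dist x y"
      unfolding dist_Pair_Pair dist_real_def by (rule sqrt_sum_squares_le_sum) auto
    then show ?thesis using that \<kappa>(2) by force
  qed
  obtain C :: "'a set" where C: "finite C" "UNIV \<subseteq> (\<Union>c\<in>C. ball c (\<kappa> / 8))"
  proof (rule compactE_image[OF compact, of UNIV "\<lambda>c. ball c (\<kappa> / 8)"])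
    show "UNIV \<subseteq> (\<Union>c\<in>UNIV. ball c (\<kappa> / 8))"
    proof
      fix x show "x \<in> (\<Union>c\<in>UNIV. ball c (\<kappa> / 8))"
        using \<kappa>(1) by (intro UN_I[of x]) auto
    qed
  qed auto
  obtain r where r: "\<kappa> / 8 < r" "r < \<kappa> / 4" "\<And>c. c \<in> C \<Longrightarrow> prob {x. dist c x = r} = 0"
    using ex_radius_null_spheres[OF C(1), of "\<kappa> / 8" "\<kappa> / 4"] \<kappa>(1) by auto
  define p where "p x = {c\<in>C. dist c x < r}" for x
  have p_close: "dist x y < \<kappa> / 2" if "p x = p y" for x y
  proof -
    obtain c where "c \<in> C" "dist c x < \<kappa> / 8"
      using subsetD[OF C(2) UNIV_I[of x]] by (auto simp: mem_ball)
    then have "c \<in> p x" using r by (auto simp: p_def)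
    moreover from this that have "c \<in> p y" by simp
    ultimately have "dist c x < r" "dist c y < r" by (auto simp: p_def)
    then show ?thesis using r(2) dist_triangle3[of x y c] by linarith
  qed
  have p: "label p" and p_locally_const: "\<And>x. \<forall>c\<in>C. dist c x \<noteq> r \<Longrightarrow> \<forall>\<^sub>F y in nhds x. p y = p x"
    unfolding p_def by (rule label_balls[OF C(1)], rule eventually_balls_eq[OF C(1)])

  have "metric_entropy_partition M (\<Phi> 1) (level_sets p) < \<alpha>"
    using metric_entropy_ge[OF p, of "\<Phi> 1"] \<alpha>(1) by (metis ereal_less_eq(3) not_le order_le_less_trans)
  then have "\<forall>\<^sub>F n in sequentially. H (itinerary (\<Phi> 1) p n) / real n < \<alpha>"
    by (rule order_tendstoD(2)[OF itinerary_entropy_tendsto[OF p preserves_flow]])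
  then have "\<forall>\<^sub>F n in sequentially. 1 \<le> n \<and> H (itinerary (\<Phi> 1) p n) / real n < \<alpha>"
    by (intro eventually_conj eventually_ge_at_top)
  from eventually_happens'[OF sequentially_bot this]
  obtain m where m: "m \<ge> 1" "H (itinerary (\<Phi> 1) p m) / real m < \<alpha>"
    by blast
  define q where "q = itinerary (\<Phi> 1) p m"
  have q_eq: "q x = q y \<longleftrightarrow> (\<forall>j<m. p (\<Phi> (real j) x) = p (\<Phi> (real j) y))" for x y
    by (simp add: q_def itinerary_eq_iff flow_funpow)
  have q: "label q" unfolding q_def by (rule label_itinerary[OF p preserves_flow])
  have Hq: "H q < \<alpha> * real m" using m by (simp add: q_def field_simps)
  have "AE x in M. \<forall>j\<in>{..<m}. \<forall>c\<in>C. dist c (\<Phi> (real j) x) \<noteq> r"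
  proof (intro AE_finite_allI C finite_lessThan)
    fix j c assume "c \<in> C"
    define Z where "Z = {x. dist c x = r}"
    have Z: "Z \<in> sets M"
      unfolding Z_def sets_eq_borel by (intro borel_closed closed_Collect_eq continuous_intros)
    have "prob (\<Phi> (real j) -` Z) = 0"
      using r(3)[OF \<open>c \<in> C\<close>] by (simp add: prob_vimage_flow[OF Z]) (simp add: Z_def)
    then have "\<Phi> (real j) -` Z \<in> null_sets M"
      using sets_vimage_flow[OF Z] by (simp add: null_sets_def emeasure_eq_measure)
    then show "AE x in M. dist c (\<Phi> (real j) x) \<noteq> r"
      by (rule AE_I') (auto simp: Z_def)
  qed
  then have q_locally_const: "AE x in M. \<forall>\<^sub>F y in nhds x. q y = q x"
  proof eventually_elim
    case (elim x)
    have "\<forall>\<^sub>F y in nhds x. p (\<Phi> (real j) y) = p (\<Phi> (real j) x)" if "j < m" for j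
    proof -
      have "isCont (\<Phi> (real j)) x"
        using continuous_on_flow_map[of UNIV] by (simp add: continuous_on_eq_continuous_at)
      then have "filterlim (\<Phi> (real j)) (nhds (\<Phi> (real j) x)) (nhds x)"
        by (simp add: continuous_at tendsto_at_iff_tendsto_nhds)
      then show ?thesis
        using elim that by (intro eventually_compose_filterlim[OF p_locally_const]) auto
    qed
    then have "\<forall>\<^sub>F y in nhds x. \<forall>j\<in>{..<m}. p (\<Phi> (real j) y) = p (\<Phi> (real j) x)"
      by (intro eventually_ball_finite) auto
    then show ?case by eventually_elim (simp add: q_eq)
  qed
  \<comment> \<open>A change of offset by at most \<open>\<eta>\<close> uses up half of \<open>\<kappa>\<close>, the diameter of the pieces the other half.\<close>
  define \<eta> where "\<eta> = min 1 (\<kappa> / 2)"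
  have \<eta>: "0 < \<eta>" "\<eta> \<le> 1" "\<eta> \<le> \<kappa> / 2" using \<kappa>(1) by (auto simp: \<eta>_def)
  have close: "dist (\<Phi> t a) (\<Phi> t b) < \<rho>"
    if ab: "q (\<Phi> u a) = q (\<Phi> u' b)" "0 \<le> u" "u \<le> \<eta>" "0 \<le> u'" "u' \<le> \<eta>" and t: "0 \<le> t" "t \<le> real m"
    for a b u u' t
  proof -
    \<comment> \<open>The minimum treats the end point \<open>t = m\<close> as belonging to the last unit interval.\<close>
    define j where "j = min (nat \<lfloor>t\<rfloor>) (m - 1)"
    have j: "j < m" "real j \<le> t" "t \<le> real j + 1"
      using m(1) t by (auto simp: j_def min_def; linarith)+
    have "dist (\<Phi> (t - real j - u) (\<Phi> (real j) (\<Phi> u a))) (\<Phi> (t - real j - u') (\<Phi> (real j) (\<Phi> u' b))) < \<rho>"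
    proof (intro near p_close)
      show "\<bar>t - real j - u\<bar> \<le> 1" "\<bar>t - real j - u'\<bar> \<le> 1"
        and "\<bar>(t - real j - u) - (t - real j - u')\<bar> \<le> \<kappa> / 2"
        using ab(2-5) j(2,3) \<eta> unfolding abs_le_iff by linarith+
      show "p (\<Phi> (real j) (\<Phi> u a)) = p (\<Phi> (real j) (\<Phi> u' b))"
        using ab(1) j(1) by (simp add: q_eq)
    qed
    then show ?thesis by (simp add: flow_add)
  qed
  have "entropy_outer_measure (flow_exit_time \<Phi> \<U>) (flow_generic_points M \<Phi>) \<alpha> = 0"
  proof (rule entropy_outer_measure_generic_points_eq_0[OF q Hq _ \<eta>(1) q_locally_const \<rho>(2)])
    show "0 < real m" using m(1) by simp
  qed (rule close)
  moreover have "0 < \<alpha> * real m" using Hq H_nonneg[of q] by linarith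
  then have "0 < \<alpha>" by (simp add: zero_less_mult_iff)
  ultimately have "cover_entropy (flow_exit_time \<Phi> \<U>) (flow_generic_points M \<Phi>) \<le> ereal \<alpha>"
    unfolding cover_entropy_def by (intro Inf_lower) auto
  with \<alpha>(2) show False by simp
qed

lemma flow_topological_entropy_generic_points_le:
  assumes "compact (UNIV :: 'a set)"
  shows "flow_topological_entropy \<Phi> (flow_generic_points M \<Phi>) \<le> metric_entropy M (\<Phi> 1)"
  unfolding flow_topological_entropy_def
  by (rule SUP_least) (simp add: cover_entropy_generic_points_le assms)

lemma metric_entropy_le_flow_topological_entropy:
  assumes compact: "compact (UNIV :: 'a set)" and \<tau>: "\<tau> > 0" and sat: "map_saturated (\<Phi> \<tau>)"
  shows "metric_entropy M (\<Phi> 1) \<le> flow_topological_entropy \<Phi> (flow_generic_points M \<Phi>)"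
proof -
  have "M \<in> map_invariant_measures (\<Phi> \<tau>)"
    by (simp add: map_invariant_measures_def prob_space_axioms sets_eq_borel invariant)
  then have "metric_entropy M (\<Phi> \<tau>) = map_topological_entropy (\<Phi> \<tau>) (map_generic_points M (\<Phi> \<tau>))"
    using sat by (simp add: map_saturated_def)
  also have "\<dots> \<le> ereal \<tau> * flow_topological_entropy \<Phi> (map_generic_points M (\<Phi> \<tau>))"
    by (rule map_topological_entropy_le_scaled[OF \<tau>])
  also have "\<dots> \<le> ereal \<tau> * flow_topological_entropy \<Phi> (flow_generic_points M \<Phi>)"
    using \<tau> map_generic_points_subset_flow_generic_points[OF compact \<tau>]
    by (intro ereal_mult_left_mono flow_topological_entropy_mono) auto
  finally have "metric_entropy M (\<Phi> \<tau>) / ereal \<tau> \<le> flow_topological_entropy \<Phi> (flow_generic_points M \<Phi>)"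
    using \<tau> by (simp add: ereal_divide_le_pos)
  with time_scaled_metric_entropy_le[OF \<tau>] show ?thesis by (rule order_trans)
qed

end

section \<open>Saturation\<close>

theorem theorem3:
  fixes \<Phi> :: "real \<Rightarrow> 'a::metric_space \<Rightarrow> 'a"
  assumes "compact (UNIV :: 'a set)"
    and "continuous_flow \<Phi>"
    and "\<exists>t>0. map_saturated (\<Phi> t)"
  shows "flow_saturated \<Phi>"
  unfolding flow_saturated_def
proof
  fix M assume M: "M \<in> flow_invariant_measures \<Phi>"
  interpret prob_space M
    using M by (simp add: flow_invariant_measures_def)
  interpret invariant_flow \<Phi> M
    using M assms(2) by unfold_locales (auto simp: flow_invariant_measures_def)
  obtain \<tau> where "\<tau> > 0" "map_saturated (\<Phi> \<tau>)" using assms(3) by blast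
  then show "flow_topological_entropy \<Phi> (flow_generic_points M \<Phi>) = flow_metric_entropy M \<Phi>"
    unfolding flow_metric_entropy_def
    by (intro antisym flow_topological_entropy_generic_points_le
        metric_entropy_le_flow_topological_entropy assms(1))
qed

end
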